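(* Let $G$ be a local analytic Moufang loop. Then its tangent algebra $\Gamma=\{T_e(G),[\cdot,\cdot]\}$, equipped with its binary bracket $[\cdot,\cdot]$ and the ternary Yamaguti brackets $$[x,y,z]=[x,[y,z]]-[y,[x,z]]+[[x,y],z],$$ is a general Lie triple system.
   Context: A local analytic Moufang loop $G$ is a (real) analytic manifold, considered near a point $e$, with an analytic multiplication defined near $e$ that has two-sided identity $e$, has invertible left and right translations near $e$, and satisfies the Moufang identity $(ag)(ha)=a(gh)a$ near $e$. Its tangent algebra is $\Gamma=\{T_e(G),[\cdot,\cdot]\}$: in local coordinates centred at $e$ in which $(gh)^i=g^i+h^i+a^i_{jk}g^jh^k+\cdots$ (higher-order terms omitted), the bilinear bracket is $[x,y]^i=(a^i_{jk}-a^i_{kj})x^jy^k$. It is known that $\Gamma$ is a Mal'tsev algebra: $[x,y]=-[y,x]$ and $J(x,y,[x,z])=[J(x,y,z),x]$, where $J(x,y,z)=[[x,y],z]+[[y,z],x]+[[z,x],y]$. A general Lie triple system is a vector space $M$ with a (bilinear) binary bracket $[\cdot,\cdot]$ and a (trilinear) ternary bracket $[\cdot,\cdot,\cdot]$ satisfying, for all elements of $M$: (a) $[x,y]=-[y,x]$; (b) $[x,y,z]=-[y,x,z]$; (c) $[x,y,z]+[y,z,x]+[z,x,y]+[[x,y],z]+[[y,z],x]+[[z,x],y]=0$; (d) $[[x,y],z,u]+[[y,z],x,u]+[[z,x],y,u]=0$; (e) $[x,y,[z,u]]=[[x,y,z],u]+[z,[x,y,u]]$; (f) $[x,y,[z,w,v]]=[[x,y,z],w,v]+[z,[x,y,w],v]+[z,w,[x,y,v]]$.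 *)

theory Defs
  imports
    "HOL-Analysis.Analysis"
    "HOL-Library.Landau_Symbols"
    "HOL-Library.Function_Algebras"
begin

section \<open>Real-analytic functions of several variables\<close>

text \<open>Multi-indices are functions \<open>\<alpha>\<close> on the orthonormal basis, extended by 0. Convergence is
  unconditional, hence absolute when the codomain is finite-dimensional.\<close>

definition multi_indices :: "('a::euclidean_space \<Rightarrow> nat) set" where
  "multi_indices = {\<alpha>. \<forall>b. b \<notin> Basis \<longrightarrow> \<alpha> b = 0}"

definition real_analytic_at ::
    "('a::euclidean_space \<Rightarrow> 'b::real_normed_vector) \<Rightarrow> 'a \<Rightarrow> bool" where
  "real_analytic_at f p \<longleftrightarrow>
    (\<exists>(c :: ('a \<Rightarrow> nat) \<Rightarrow> 'b) r. r > 0 \<and>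
      (\<forall>x\<in>ball p r.
        ((\<lambda>\<alpha>. (\<Prod>b\<in>Basis. ((x - p) \<bullet> b) ^ \<alpha> b) *\<^sub>R c \<alpha>) has_sum f x) multi_indices))"

section \<open>Real-analytic manifolds\<close>

text \<open>A chart is a pair of its domain and its coordinate map; the values of the coordinate map
  outside the domain are irrelevant.\<close>

type_synonym ('g, 'n) chart = "'g set \<times> ('g \<Rightarrow> real ^ 'n)"

definition is_chart :: "('g::topological_space, 'n::finite) chart \<Rightarrow> bool" where
  "is_chart c \<longleftrightarrow> open (fst c) \<and> open (snd c ` fst c) \<and>
     (\<exists>\<psi>. homeomorphism (fst c) (snd c ` fst c) (snd c) \<psi>)"

definition chart_inv :: "('g, 'n::finite) chart \<Rightarrow> real ^ 'n \<Rightarrow> 'g" where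
  "chart_inv c = inv_into (fst c) (snd c)"

definition transition ::
    "('g, 'n::finite) chart \<Rightarrow> ('g, 'n) chart \<Rightarrow> real ^ 'n \<Rightarrow> real ^ 'n" where
  "transition c d = (\<lambda>x. snd d (chart_inv c x))"

definition compatible_charts :: "('g, 'n::finite) chart \<Rightarrow> ('g, 'n) chart \<Rightarrow> bool" where
  "compatible_charts c d \<longleftrightarrow>
     (\<forall>x \<in> snd c ` (fst c \<inter> fst d). real_analytic_at (transition c d) x) \<and>
     (\<forall>x \<in> snd d ` (fst c \<inter> fst d). real_analytic_at (transition d c) x)"

text \<open>\<open>A\<close> is a maximal atlas, so that it consists of all local coordinate systems of the
  analytic manifold whose underlying (Hausdorff) space is the type \<open>'g\<close>.\<close>

definition analytic_manifold :: "('g::t2_space, 'n::finite) chart set \<Rightarrow> bool" where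
  "analytic_manifold A \<longleftrightarrow>
     (\<forall>c\<in>A. is_chart c) \<and>
     (\<Union>c\<in>A. fst c) = UNIV \<and>
     (\<forall>c\<in>A. \<forall>d\<in>A. compatible_charts c d) \<and>
     (\<forall>c. is_chart c \<and> (\<forall>d\<in>A. compatible_charts c d) \<longrightarrow> c \<in> A)"

definition charts_at :: "('g, 'n::finite) chart set \<Rightarrow> 'g \<Rightarrow> ('g, 'n) chart set" where
  "charts_at A p = {c \<in> A. p \<in> fst c}"

definition centred_charts :: "('g, 'n::finite) chart set \<Rightarrow> 'g \<Rightarrow> ('g, 'n) chart set" where
  "centred_charts A p = {c \<in> charts_at A p. snd c p = 0}"

section \<open>Tangent spaces\<close>

instantiation "fun" :: (type, real_vector) real_vector
begin

definition scaleR_fun :: "real \<Rightarrow> ('a \<Rightarrow> 'b) \<Rightarrow> 'a \<Rightarrow> 'b" where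
  "scaleR_fun r f = (\<lambda>x. r *\<^sub>R f x)"

instance
  by standard (auto simp: scaleR_fun_def fun_eq_iff scaleR_add_right scaleR_add_left)

end

text \<open>A tangent vector at \<open>p\<close> assigns to each chart \<open>c\<close> at \<open>p\<close> its vector \<open>v c\<close> of components, in
  such a way that components transform by the Jacobian of the coordinate change. The vector space
  operations are pointwise.\<close>

type_synonym ('g, 'n) tangent_vector = "('g, 'n) chart \<Rightarrow> real ^ 'n"

definition tangent_space ::
    "('g, 'n::finite) chart set \<Rightarrow> 'g \<Rightarrow> ('g, 'n) tangent_vector set" where
  "tangent_space A p =
     {v. (\<forall>c\<in>charts_at A p. \<forall>d\<in>charts_at A p.
            v d = frechet_derivative (transition c d) (at (snd c p)) (v c)) \<and>
         (\<forall>c. c \<notin> charts_at A p \<longrightarrow> v c = 0)}"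

section \<open>Local analytic Moufang loops\<close>

text \<open>The partial multiplication is represented by a total function \<open>m\<close>, of which only the values
  on the open domain \<open>D\<close> are meaningful.\<close>

definition analytic_mult ::
    "('g::t2_space, 'n::finite) chart set \<Rightarrow> ('g \<times> 'g) set \<Rightarrow> ('g \<Rightarrow> 'g \<Rightarrow> 'g) \<Rightarrow> bool" where
  "analytic_mult A D m \<longleftrightarrow>
     continuous_on D (\<lambda>(g, h). m g h) \<and>
     (\<forall>(g, h)\<in>D. \<forall>b\<in>charts_at A g. \<forall>c\<in>charts_at A h. \<forall>d\<in>charts_at A (m g h).
        real_analytic_at (\<lambda>(x, y). snd d (m (chart_inv b x) (chart_inv c y))) (snd b g, snd c h))"

text \<open>Invertibility of translations near \<open>e\<close>: for \<open>a\<close> close to \<open>e\<close>, the translations by \<open>a\<close> are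
  injective on a fixed neighbourhood \<open>N\<close> of \<open>e\<close>, and their local inverses are defined on a fixed
  neighbourhood \<open>V\<close> of \<open>e\<close>. For the Moufang identity, \<open>V\<close> is also small enough for both sides to
  be defined.\<close>

definition local_analytic_Moufang_loop ::
    "('g::t2_space, 'n::finite) chart set \<Rightarrow> 'g \<Rightarrow> ('g \<times> 'g) set \<Rightarrow> ('g \<Rightarrow> 'g \<Rightarrow> 'g) \<Rightarrow> bool" where
  "local_analytic_Moufang_loop A e D m \<longleftrightarrow>
     analytic_manifold A \<and>
     open D \<and> (e, e) \<in> D \<and> analytic_mult A D m \<and>
     (\<forall>\<^sub>F g in nhds e. m e g = g \<and> m g e = g) \<and>
     (\<exists>N V. open N \<and> e \<in> N \<and> open V \<and> e \<in> V \<and> V \<times> N \<subseteq> D \<and> N \<times> V \<subseteq> D \<and>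
        (\<forall>a\<in>V. inj_on (\<lambda>x. m a x) N \<and> V \<subseteq> (\<lambda>x. m a x) ` N \<and>
               inj_on (\<lambda>x. m x a) N \<and> V \<subseteq> (\<lambda>x. m x a) ` N)) \<and>
     (\<exists>V. open V \<and> e \<in> V \<and>
        (\<forall>a\<in>V. \<forall>g\<in>V. \<forall>h\<in>V.
           {(a, g), (h, a), (g, h), (m a g, m h a), (a, m g h), (m a (m g h), a)} \<subseteq> D \<and>
           m (m a g) (m h a) = m (m a (m g h)) a))"

section \<open>The tangent algebra\<close>

definition local_mult ::
    "('g, 'n::finite) chart \<Rightarrow> ('g \<Rightarrow> 'g \<Rightarrow> 'g) \<Rightarrow> real ^ 'n \<Rightarrow> real ^ 'n \<Rightarrow> real ^ 'n" where
  "local_mult c m x y = snd c (m (chart_inv c x) (chart_inv c y))"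

text \<open>The coefficients \<open>a i j k\<close> in the expansion
  \<open>(gh)\<^sup>i = g\<^sup>i + h\<^sup>i + (\<Sum>j k. a i j k g\<^sup>j h\<^sup>k) + \<dots>\<close>
  with respect to a chart centred at \<open>e\<close>, where the omitted terms have order at least 3.
  Since \<open>e\<close> is a two-sided identity, the expansion has this form in every such chart.\<close>

definition structure_coeffs ::
    "('g, 'n::finite) chart \<Rightarrow> ('g \<Rightarrow> 'g \<Rightarrow> 'g) \<Rightarrow> 'n \<Rightarrow> 'n \<Rightarrow> 'n \<Rightarrow> real" where
  "structure_coeffs c m = (THE a. \<forall>i.
     (\<lambda>(x, y). local_mult c m x y $ i
        - (x $ i + y $ i + (\<Sum>j\<in>UNIV. \<Sum>k\<in>UNIV. a i j k * x $ j * y $ k)))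
     \<in> O[nhds (0, 0)](\<lambda>p. norm p ^ 3))"

text \<open>The bracket of \<open>v\<close> and \<open>w\<close> is the tangent vector whose components in the chart \<open>c\<close> centred
  at \<open>e\<close> are given by the antisymmetrised coefficients.\<close>

definition tangent_bracket ::
    "('g, 'n::finite) chart set \<Rightarrow> 'g \<Rightarrow> ('g \<Rightarrow> 'g \<Rightarrow> 'g) \<Rightarrow> ('g, 'n) chart \<Rightarrow>
     ('g, 'n) tangent_vector \<Rightarrow> ('g, 'n) tangent_vector \<Rightarrow> ('g, 'n) tangent_vector" where
  "tangent_bracket A e m c v w = (THE u. u \<in> tangent_space A e \<and>
     (\<forall>i. u c $ i = (\<Sum>j\<in>UNIV. \<Sum>k\<in>UNIV.
        (structure_coeffs c m i j k - structure_coeffs c m i k j) * v c $ j * w c $ k)))"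

section \<open>General Lie triple systems\<close>

definition yamaguti_bracket :: "('v::ab_group_add \<Rightarrow> 'v \<Rightarrow> 'v) \<Rightarrow> 'v \<Rightarrow> 'v \<Rightarrow> 'v \<Rightarrow> 'v" where
  "yamaguti_bracket B x y z = B x (B y z) - B y (B x z) + B (B x y) z"

definition linear_map_on :: "'v::real_vector set \<Rightarrow> ('v \<Rightarrow> 'v) \<Rightarrow> bool" where
  "linear_map_on M f \<longleftrightarrow>
     (\<forall>x\<in>M. f x \<in> M) \<and>
     (\<forall>x\<in>M. \<forall>y\<in>M. f (x + y) = f x + f y) \<and>
     (\<forall>r. \<forall>x\<in>M. f (r *\<^sub>R x) = r *\<^sub>R f x)"

locale general_Lie_triple_system =
  fixes M :: "'v::real_vector set"
    and B :: "'v \<Rightarrow> 'v \<Rightarrow> 'v"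
    and T :: "'v \<Rightarrow> 'v \<Rightarrow> 'v \<Rightarrow> 'v"
  assumes subspace: "subspace M"
    and bilinear: "\<lbrakk>x \<in> M; y \<in> M\<rbrakk> \<Longrightarrow> linear_map_on M (\<lambda>z. B z y) \<and> linear_map_on M (B x)"
    and trilinear: "\<lbrakk>x \<in> M; y \<in> M; z \<in> M\<rbrakk> \<Longrightarrow>
      linear_map_on M (\<lambda>w. T w y z) \<and> linear_map_on M (\<lambda>w. T x w z) \<and> linear_map_on M (T x y)"
    and B_skew: "\<lbrakk>x \<in> M; y \<in> M\<rbrakk> \<Longrightarrow> B x y = - B y x"
    and T_skew: "\<lbrakk>x \<in> M; y \<in> M; z \<in> M\<rbrakk> \<Longrightarrow> T x y z = - T y x z"
    and T_cyclic: "\<lbrakk>x \<in> M; y \<in> M; z \<in> M\<rbrakk> \<Longrightarrow>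
      T x y z + T y z x + T z x y + B (B x y) z + B (B y z) x + B (B z x) y = 0"
    and T_B_cyclic: "\<lbrakk>x \<in> M; y \<in> M; z \<in> M; u \<in> M\<rbrakk> \<Longrightarrow>
      T (B x y) z u + T (B y z) x u + T (B z x) y u = 0"
    and T_deriv_B: "\<lbrakk>x \<in> M; y \<in> M; z \<in> M; u \<in> M\<rbrakk> \<Longrightarrow>
      T x y (B z u) = B (T x y z) u + B z (T x y u)"
    and T_deriv_T: "\<lbrakk>x \<in> M; y \<in> M; z \<in> M; w \<in> M; v \<in> M\<rbrakk> \<Longrightarrow>
      T x y (T z w v) = T (T x y z) w v + T z (T x y w) v + T z w (T x y v)"

end

theory Submission
  imports Defs
begin

text \<open>In a chart centred at \<open>e\<close> the multiplication has a Taylor expansion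
\<open>xy = x + y + B(x,y) + \<dots>\<close>, and the bracket is \<open>[x,y] = B(x,y) - B(y,x)\<close>. The identities of a general
Lie triple system that need an argument are multilinear of degree four (the derivation identity of
\<open>[x,y,-]\<close> for the ternary bracket follows formally from the one for the binary bracket), so only
the expansion up to order four matters.

Let \<open>A(x,y,z) = (xy)z - x(yz)\<close>, computed in the chart, and let \<open>A\<^sub>i\<^sub>j\<^sub>k\<close> be its polarized part of
degrees \<open>i, j, k\<close> in \<open>x, y, z\<close>. The terms of the Moufang identity \<open>(ag)(ha) = a(gh)a\<close> that are linear in
\<open>a\<close> are those of \<open>(ag)h + g(ha) = a(gh) + (gh)a\<close>, that is, \<open>A(a,g,h) = A(g,h,a)\<close>; and for \<open>g = e\<close> the
identity reads \<open>A(a,h,a) = 0\<close>. In order three this makes \<open>A\<^sub>1\<^sub>1\<^sub>1\<close> alternating. Since the Jacobian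
\<open>J(x,y,z)\<close> of the bracket is the alternating sum of \<open>A\<^sub>1\<^sub>1\<^sub>1\<close> in any loop, \<open>J = 6 A\<^sub>1\<^sub>1\<^sub>1\<close>. In order four the
two relations express \<open>A\<^sub>2\<^sub>1\<^sub>1\<close> and \<open>A\<^sub>1\<^sub>1\<^sub>2\<close> by \<open>A\<^sub>1\<^sub>2\<^sub>1\<close>, which is symmetric in its two middle and skew in its two
outer arguments.

A further relation holds in every loop: passing round the pentagon of the five bracketings of
\<open>xyzw\<close> links \<open>A\<^sub>2\<^sub>1\<^sub>1\<close>, \<open>A\<^sub>1\<^sub>2\<^sub>1\<close>, \<open>A\<^sub>1\<^sub>1\<^sub>2\<close> to \<open>B\<close> and \<open>A\<^sub>1\<^sub>1\<^sub>1\<close> (lemma \<open>pentagon\<close>). In the Moufang case it contains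
only \<open>A\<^sub>1\<^sub>2\<^sub>1\<close>, and a signed sum of six of its permutations eliminates \<open>A\<^sub>1\<^sub>2\<^sub>1\<close>. What remains is
  \<open>[J(x,y,z),w] - [J(x,y,w),z] = 2 J([x,y],z,w) + J([z,w],x,y)\<close>
(lemma \<open>bracket_Malcev_identity\<close>). As \<open>[x,y,z] = 2 [[x,y],z] - J(x,y,z)\<close>, this says exactly that
\<open>[x,y,-]\<close> is a derivation of the bracket. The cyclic identity for \<open>[[x,y],z,u]\<close> is a linear
consequence of it.

Coefficients are compared along the curves \<open>t \<mapsto> ta, tg, th\<close>: two sides that agree for small \<open>t\<close> have
the same Taylor coefficients in \<open>t\<close> (lemma \<open>has_jet_unique\<close>), and the coefficients of a product are
determined by those of the factors (lemma \<open>has_jet_taylor\<close>). Analyticity enters only through a fourth-order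
expansion with symmetric multilinear coefficients (lemma \<open>real_analytic_expansion\<close>). Finally,
\<open>v \<mapsto> v c\<close> identifies the tangent space with \<open>\<real>\<^sup>n\<close> and the bracket with \<open>B(x,y) - B(y,x)\<close>.\<close>

section \<open>Multilinear maps\<close>

definition trilinear :: "('a::real_vector \<Rightarrow> 'b::real_vector \<Rightarrow> 'c::real_vector \<Rightarrow> 'd::real_vector) \<Rightarrow> bool" where
  "trilinear f \<longleftrightarrow> (\<forall>x. bilinear (f x)) \<and> (\<forall>y z. linear (\<lambda>x. f x y z))"

definition quadrilinear ::
    "('a::real_vector \<Rightarrow> 'b::real_vector \<Rightarrow> 'c::real_vector \<Rightarrow> 'd::real_vector \<Rightarrow> 'e::real_vector) \<Rightarrow> bool" where
  "quadrilinear f \<longleftrightarrow> (\<forall>x. trilinear (f x)) \<and> (\<forall>y z w. linear (\<lambda>x. f x y z w))"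

lemma linear_map_simps:
  assumes "linear f"
  shows "f (x + y) = f x + f y" "f (x - y) = f x - f y" "f (r *\<^sub>R x) = r *\<^sub>R f x" "f (- x) = - f x" "f 0 = 0"
  using assms by (simp_all add: linear_add linear_diff linear_scale linear_neg linear_0)

lemma bilinear_linear:
  assumes "bilinear f"
  shows "linear (\<lambda>x. f x y)" "linear (\<lambda>y. f x y)"
  using assms by (auto simp: bilinear_def)

lemma trilinear_linear:
  assumes "trilinear f"
  shows "linear (\<lambda>x. f x y z)" "linear (\<lambda>y. f x y z)" "linear (\<lambda>z. f x y z)"
  using assms by (auto simp: trilinear_def bilinear_def)

lemma quadrilinear_linear:
  assumes "quadrilinear f"
  shows "linear (\<lambda>x. f x y z w)" "linear (\<lambda>y. f x y z w)" "linear (\<lambda>z. f x y z w)" "linear (\<lambda>w. f x y z w)"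
  using assms trilinear_linear[of "f _"] by (auto simp: quadrilinear_def)

lemmas bilinear_simps =
  bilinear_linear[THEN linear_map_simps(1)]
  bilinear_linear[THEN linear_map_simps(2)]
  bilinear_linear[THEN linear_map_simps(3)]
  bilinear_linear[THEN linear_map_simps(4)]
  bilinear_linear[THEN linear_map_simps(5)]

lemmas trilinear_simps =
  trilinear_linear[THEN linear_map_simps(1)]
  trilinear_linear[THEN linear_map_simps(2)]
  trilinear_linear[THEN linear_map_simps(3)]
  trilinear_linear[THEN linear_map_simps(4)]
  trilinear_linear[THEN linear_map_simps(5)]

lemmas quadrilinear_simps =
  quadrilinear_linear[THEN linear_map_simps(1)]
  quadrilinear_linear[THEN linear_map_simps(2)]
  quadrilinear_linear[THEN linear_map_simps(3)]
  quadrilinear_linear[THEN linear_map_simps(4)]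
  quadrilinear_linear[THEN linear_map_simps(5)]

lemma linear_Basis_sum:
  fixes f :: "'a::euclidean_space \<Rightarrow> 'b::real_vector"
  assumes "linear f" shows "f x = (\<Sum>b\<in>Basis. (x \<bullet> b) *\<^sub>R f b)"
proof -
  have "f x = f (\<Sum>b\<in>Basis. (x \<bullet> b) *\<^sub>R b)" by (simp add: euclidean_representation)
  also have "\<dots> = (\<Sum>b\<in>Basis. (x \<bullet> b) *\<^sub>R f b)"
    using assms by (simp add: linear_sum linear_scale)
  finally show ?thesis .
qed

lemma bilinear_comp:
  assumes "bilinear f" "linear g" "linear h"
  shows "bilinear (\<lambda>x y. f (g x) (h y))"
  using linear_compose[OF assms(2) bilinear_linear(1)[OF assms(1)]] linear_compose[OF assms(3) bilinear_linear(2)[OF assms(1)]]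
  by (simp add: bilinear_def o_def)

lemma trilinear_comp:
  assumes "trilinear f" "linear g" "linear h" "linear i"
  shows "trilinear (\<lambda>x y z. c *\<^sub>R f (g x) (h y) (i z))"
  using linear_compose[OF assms(2) trilinear_linear(1)[OF assms(1)]]
    linear_compose[OF assms(3) trilinear_linear(2)[OF assms(1)]]
    linear_compose[OF assms(4) trilinear_linear(3)[OF assms(1)]]
  by (simp add: trilinear_def bilinear_def o_def linear_compose_scale_right)

lemma quadrilinear_comp:
  assumes "quadrilinear f" "linear g" "linear h" "linear i" "linear j"
  shows "quadrilinear (\<lambda>x y z w. c *\<^sub>R f (g x) (h y) (i z) (j w))"
  using linear_compose[OF assms(2) quadrilinear_linear(1)[OF assms(1)]]
    linear_compose[OF assms(3) quadrilinear_linear(2)[OF assms(1)]]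
    linear_compose[OF assms(4) quadrilinear_linear(3)[OF assms(1)]]
    linear_compose[OF assms(5) quadrilinear_linear(4)[OF assms(1)]]
  by (simp add: quadrilinear_def trilinear_def bilinear_def o_def linear_compose_scale_right)

lemma linear_inl: "linear (\<lambda>x. (x, 0))" and linear_inr: "linear (\<lambda>y. (0, y))"
  by (auto intro!: linearI)

lemma trilinear_bound:
  fixes f :: "'a::euclidean_space \<Rightarrow> 'b::euclidean_space \<Rightarrow> 'c::euclidean_space \<Rightarrow> 'd::real_normed_vector"
  assumes "trilinear f"
  obtains K where "\<And>x y z. norm (f x y z) \<le> K * norm x * norm y * norm z"
proof -
  have "\<exists>K. \<forall>y z. norm (f b y z) \<le> norm y * norm z * K" for b
    using assms bounded_bilinear.bounded bilinear_conv_bounded_bilinear unfolding trilinear_def by blast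
  then obtain K where K: "\<And>b y z. norm (f b y z) \<le> norm y * norm z * K b" by metis
  have "norm (f x y z) \<le> (\<Sum>b\<in>Basis. K b) * norm x * norm y * norm z" for x y z
  proof -
    have "f x y z = (\<Sum>b\<in>Basis. (x \<bullet> b) *\<^sub>R f b y z)"
      using linear_Basis_sum[OF trilinear_linear(1)[OF assms]] .
    also have "norm \<dots> \<le> (\<Sum>b\<in>Basis. norm ((x \<bullet> b) *\<^sub>R f b y z))" by (rule norm_sum)
    also have "\<dots> \<le> (\<Sum>b\<in>Basis. norm x * (norm y * norm z * K b))"
      using K by (intro sum_mono) (auto intro!: mult_mono Basis_le_norm)
    finally show ?thesis by (simp add: sum_distrib_left sum_distrib_right mult_ac)
  qed
  then show thesis by (rule that)
qed

lemma quadrilinear_bound: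
  fixes f :: "'a::euclidean_space \<Rightarrow> 'b::euclidean_space \<Rightarrow> 'c::euclidean_space \<Rightarrow> 'd::euclidean_space \<Rightarrow> 'e::real_normed_vector"
  assumes "quadrilinear f"
  obtains K where "\<And>x y z w. norm (f x y z w) \<le> K * norm x * norm y * norm z * norm w"
proof -
  have "\<exists>K. \<forall>y z w. norm (f b y z w) \<le> K * norm y * norm z * norm w" for b
    using assms trilinear_bound[of "f b"] unfolding quadrilinear_def by metis
  then obtain K where K: "\<And>b y z w. norm (f b y z w) \<le> K b * norm y * norm z * norm w" by metis
  have "norm (f x y z w) \<le> (\<Sum>b\<in>Basis. K b) * norm x * norm y * norm z * norm w" for x y z w
  proof -
    have "f x y z w = (\<Sum>b\<in>Basis. (x \<bullet> b) *\<^sub>R f b y z w)"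
      using linear_Basis_sum[OF quadrilinear_linear(1)[OF assms]] .
    also have "norm \<dots> \<le> (\<Sum>b\<in>Basis. norm ((x \<bullet> b) *\<^sub>R f b y z w))" by (rule norm_sum)
    also have "\<dots> \<le> (\<Sum>b\<in>Basis. norm x * (K b * norm y * norm z * norm w))"
      using K by (intro sum_mono) (auto intro!: mult_mono Basis_le_norm)
    finally show ?thesis by (simp add: sum_distrib_left sum_distrib_right mult_ac)
  qed
  then show thesis by (rule that)
qed

section \<open>Jets of curves\<close>

text \<open>The Taylor coefficients of \<open>f\<close> at 0 up to order four are \<open>u 0, \<dots>, u 4\<close>, where \<open>t\<close> tends to 0 through
nonzero values.\<close>
definition has_jet :: "(real \<Rightarrow> 'a::real_normed_vector) \<Rightarrow> (nat \<Rightarrow> 'a) \<Rightarrow> bool" where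
  "has_jet f u \<longleftrightarrow> (\<lambda>t. norm (f t - (\<Sum>k<5. t ^ k *\<^sub>R u k))) \<in> O[at 0](\<lambda>t. t ^ 5)"

lemma norm_bigo_add:
  assumes "(\<lambda>t. norm (f t)) \<in> O[F](g)" "(\<lambda>t. norm (h t)) \<in> O[F](g)"
  shows "(\<lambda>t. norm (f t + h t)) \<in> O[F](g)"
proof -
  have "(\<lambda>t. norm (f t + h t)) \<in> O[F](\<lambda>t. norm (f t) + norm (h t))"
    by (intro landau_o.big_mono always_eventually) (auto simp: norm_triangle_ineq)
  also have "(\<lambda>t. norm (f t) + norm (h t)) \<in> O[F](g)"
    using assms by (rule sum_in_bigo)
  finally show ?thesis .
qed

lemma has_jet_add:
  assumes "has_jet f u" "has_jet g v"
  shows "has_jet (\<lambda>t. f t + g t) (\<lambda>k. u k + v k)"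
  using norm_bigo_add[OF assms[unfolded has_jet_def]]
  by (simp add: has_jet_def algebra_simps sum.distrib)

lemma has_jet_0: "has_jet (\<lambda>t. 0) (\<lambda>k. 0)"
  by (simp add: has_jet_def)

lemma has_jet_sum:
  assumes "\<And>i. i \<in> I \<Longrightarrow> has_jet (f i) (u i)"
  shows "has_jet (\<lambda>t. \<Sum>i\<in>I. f i t) (\<lambda>k. \<Sum>i\<in>I. u i k)"
  using assms
proof (induction I rule: infinite_finite_induct)
  case (insert i I)
  then show ?case using has_jet_add[of "f i" "u i"] by simp
qed (auto simp: has_jet_0)

lemma has_jet_cong:
  assumes "has_jet f u" "\<forall>\<^sub>F t in at 0. f t = g t" "\<And>k. k < 5 \<Longrightarrow> u k = v k"
  shows "has_jet g v"
proof -
  have "(\<lambda>t. norm (f t - (\<Sum>k<5. t ^ k *\<^sub>R u k))) \<in> O[at 0](\<lambda>t. t ^ 5) \<longleftrightarrow>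
    (\<lambda>t. norm (g t - (\<Sum>k<5. t ^ k *\<^sub>R v k))) \<in> O[at 0](\<lambda>t. t ^ 5)"
    using assms(2) by (intro landau_o.big.in_cong) (auto elim!: eventually_mono simp: assms(3) )
  then show ?thesis using assms(1) by (simp add: has_jet_def)
qed

lemma has_jet_poly: "has_jet (\<lambda>t. \<Sum>k<5. t ^ k *\<^sub>R u k) u"
  by (simp add: has_jet_def)

lemma power_bigo:
  assumes "m \<le> n" shows "(\<lambda>t::real. t ^ n) \<in> O[at 0](\<lambda>t. t ^ m)"
proof (rule bigoI[where c = 1])
  have "\<forall>\<^sub>F t in at 0. \<bar>t::real\<bar> < 1"
    unfolding eventually_at by (auto intro!: exI[of _ 1])
  then show "\<forall>\<^sub>F t in at 0. norm (t ^ n) \<le> 1 * norm (t ^ m :: real)"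
    by eventually_elim (use assms in \<open>simp add: power_abs power_decreasing\<close>)
qed

lemma has_jet_monomial:
  assumes "n \<ge> 5"
  shows "has_jet (\<lambda>t. t ^ n *\<^sub>R a) (\<lambda>k. 0)"
proof -
  have "(\<lambda>t. norm (t ^ n *\<^sub>R a)) \<in> O[at 0](\<lambda>t. t ^ n)"
    by (rule bigoI[of _ "norm a"]) (simp add: mult.commute)
  from landau_o.big_trans[OF this power_bigo[OF assms]] show ?thesis by (simp add: has_jet_def)
qed

lemma has_jet_bounded:
  assumes "has_jet f u"
  shows "(\<lambda>t. norm (f t)) \<in> O[at 0](\<lambda>_. 1)"
proof -
  have "(\<lambda>t. norm (f t - (\<Sum>k<5. t ^ k *\<^sub>R u k))) \<in> O[at 0](\<lambda>_. 1)"
    using landau_o.big_trans[OF assms[unfolded has_jet_def] power_bigo[of 0 5]] by simp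
  moreover have "(\<lambda>t. norm (\<Sum>k<5. t ^ k *\<^sub>R u k)) \<in> O[at 0](\<lambda>_. 1::real)"
  proof (rule bigoI_tendsto)
    show "((\<lambda>t. norm (\<Sum>k<5. t ^ k *\<^sub>R u k) / 1) \<longlongrightarrow> norm (\<Sum>k<5. 0 ^ k *\<^sub>R u k) / 1) (at 0)"
      by (intro tendsto_intros) auto
  qed auto
  ultimately have "(\<lambda>t. norm (f t - (\<Sum>k<5. t ^ k *\<^sub>R u k) + (\<Sum>k<5. t ^ k *\<^sub>R u k))) \<in> O[at 0](\<lambda>_. 1)"
    by (rule norm_bigo_add)
  then show ?thesis by simp
qed

text \<open>The Cauchy product. Replacing each factor by its Taylor polynomial costs an error of order five, since
the other factor stays bounded.\<close>
lemma (in bounded_bilinear) has_jet: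
  assumes f: "has_jet f u" and g: "has_jet g v"
  shows "has_jet (\<lambda>t. prod (f t) (g t)) (\<lambda>k. \<Sum>i\<le>k. prod (u i) (v (k - i)))"
proof -
  obtain K where K: "\<And>a b. norm (prod a b) \<le> norm a * norm b * K" using bounded by blast
  define U where "U t = (\<Sum>k<5. t ^ k *\<^sub>R u k)" for t
  define V where "V t = (\<Sum>k<5. t ^ k *\<^sub>R v k)" for t
  have big: "(\<lambda>t. norm (prod (p t) (q t))) \<in> O[at 0](\<lambda>t. r t * s t)"
    if "(\<lambda>t. norm (p t)) \<in> O[at 0](r)" "(\<lambda>t. norm (q t)) \<in> O[at 0](s)" for p q and r s :: "real \<Rightarrow> real"
  proof -
    have "(\<lambda>t. norm (prod (p t) (q t))) \<in> O[at 0](\<lambda>t. norm (p t) * norm (q t))"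
      using K by (intro bigoI[where c = K] always_eventually) (auto simp: mult_ac abs_mult)
    also have "(\<lambda>t. norm (p t) * norm (q t)) \<in> O[at 0](\<lambda>t. r t * s t)"
      using that by (rule landau_o.big.mult)
    finally show ?thesis .
  qed
  have "has_jet U u" unfolding U_def by (rule has_jet_poly)
  have *: "(\<lambda>t. norm (prod (f t - U t) (g t) + prod (U t) (g t - V t))) \<in> O[at 0](\<lambda>t. t ^ 5)"
    using big[OF f[unfolded has_jet_def, folded U_def] has_jet_bounded[OF g]]
      big[OF has_jet_bounded[OF \<open>has_jet U u\<close>] g[unfolded has_jet_def, folded V_def]]
    by (intro norm_bigo_add) auto
  have 1: "has_jet (\<lambda>t. prod (f t - U t) (g t) + prod (U t) (g t - V t)) (\<lambda>k. 0)"
    using * by (simp add: has_jet_def)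
  have m: "has_jet (\<lambda>t. t ^ n *\<^sub>R a) (\<lambda>k. if k = n then a else 0)" for n and a :: 'c
  proof (cases "n < 5")
    case True
    have "(\<Sum>k<5. t ^ k *\<^sub>R (if k = n then a else 0)) = (\<Sum>k<5. if k = n then t ^ n *\<^sub>R a else 0)" for t :: real
      by (intro sum.cong) auto
    with True show ?thesis by (simp add: has_jet_def)
  next
    case False
    then show ?thesis by (intro has_jet_cong[OF has_jet_monomial[of n a]]) auto
  qed
  have "has_jet (\<lambda>t. \<Sum>i<5. \<Sum>j<5. t ^ (i + j) *\<^sub>R prod (u i) (v j))
      (\<lambda>k. \<Sum>i<5. \<Sum>j<5. if k = i + j then prod (u i) (v j) else 0)"
    by (intro has_jet_sum m)
  then have 2: "has_jet (\<lambda>t. \<Sum>i<5. \<Sum>j<5. t ^ (i + j) *\<^sub>R prod (u i) (v j))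
      (\<lambda>k. \<Sum>i\<le>k. prod (u i) (v (k - i)))"
  proof (rule has_jet_cong)
    fix k :: nat assume "k < 5"
    have "(\<Sum>i<5. \<Sum>j<5. if k = i + j then prod (u i) (v j) else 0)
      = (\<Sum>i<5. \<Sum>j<5. if i \<le> k \<and> j = k - i then prod (u i) (v j) else 0)"
      by (intro sum.cong) auto
    also have "\<dots> = (\<Sum>i<5. if i \<le> k then prod (u i) (v (k - i)) else 0)"
      using \<open>k < 5\<close> by (intro sum.cong) auto
    also have "\<dots> = (\<Sum>i\<le>k. prod (u i) (v (k - i)))"
      using \<open>k < 5\<close> by (intro sum.mono_neutral_cong_right) auto
    finally show "(\<Sum>i<5. \<Sum>j<5. if k = i + j then prod (u i) (v j) else 0) = \<dots>" .
  qed auto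
  have eq: "prod (U t) (V t) = (\<Sum>i<5. \<Sum>j<5. t ^ (i + j) *\<^sub>R prod (u i) (v j))" for t
    unfolding U_def V_def sum_left sum_right scaleR_left scaleR_right
    by (subst sum.swap) (simp add: power_add scaleR_sum_right mult.commute)
  have "prod (f t - U t) (g t) + prod (U t) (g t - V t) + prod (U t) (V t) = prod (f t) (g t)" for t
    by (simp add: diff_left diff_right)
  then show ?thesis using has_jet_add[OF 1 2] by (simp flip: eq)
qed

lemma (in bounded_linear) has_jet:
  assumes "has_jet g u"
  shows "has_jet (\<lambda>t. f (g t)) (\<lambda>k. f (u k))"
proof -
  obtain K where K: "\<And>a. norm (f a) \<le> norm a * K" using bounded by blast
  have "(\<lambda>t. norm (f (g t - (\<Sum>k<5. t ^ k *\<^sub>R u k)))) \<in> O[at 0](\<lambda>t. norm (g t - (\<Sum>k<5. t ^ k *\<^sub>R u k)))"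
    using K by (intro bigoI[where c = K] always_eventually) (auto simp: mult_ac)
  also have "(\<lambda>t. norm (g t - (\<Sum>k<5. t ^ k *\<^sub>R u k))) \<in> O[at 0](\<lambda>t. t ^ 5)"
    using assms by (simp add: has_jet_def)
  finally show ?thesis by (simp add: has_jet_def diff sum scaleR)
qed

lemma bigo_tendsto_0:
  fixes f :: "'a \<Rightarrow> 'b::real_normed_vector" and g :: "'a \<Rightarrow> real"
  assumes "(\<lambda>x. norm (f x)) \<in> O[F](g)" "(g \<longlongrightarrow> 0) F"
  shows "(f \<longlongrightarrow> 0) F"
proof -
  obtain c where "\<forall>\<^sub>F x in F. norm (norm (f x)) \<le> c * norm (g x)"
    using assms(1) by (elim landau_o.bigE)
  then show ?thesis
    using tendsto_mult_right_zero[OF tendsto_norm_zero[OF assms(2)], of c]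
    by (intro Lim_null_comparison[of f "\<lambda>x. c * norm (g x)"]) auto
qed

lemma has_jet_tendsto:
  assumes "has_jet f u"
  shows "(f \<longlongrightarrow> u 0) (at 0)"
proof -
  have "((\<lambda>t. f t - (\<Sum>k<5. t ^ k *\<^sub>R u k)) \<longlongrightarrow> 0) (at 0)"
    using assms unfolding has_jet_def by (rule bigo_tendsto_0) (auto intro!: tendsto_eq_intros)
  moreover have "((\<lambda>t. \<Sum>k<5. t ^ k *\<^sub>R u k) \<longlongrightarrow> (\<Sum>k<5. 0 ^ k *\<^sub>R u k)) (at (0::real))"
    by (intro tendsto_intros)
  ultimately have "((\<lambda>t. f t - (\<Sum>k<5. t ^ k *\<^sub>R u k) + (\<Sum>k<5. t ^ k *\<^sub>R u k)) \<longlongrightarrow> 0 + (\<Sum>k<5. 0 ^ k *\<^sub>R u k)) (at 0)"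
    by (rule tendsto_add)
  moreover have "(\<Sum>k<5. 0 ^ k *\<^sub>R u k) = u 0"
    by (simp add: eval_nat_numeral)
  ultimately show ?thesis by simp
qed

text \<open>Letting \<open>t\<close> tend to 0 isolates \<open>w 0\<close>; dividing by \<open>t\<close> then lowers the degree.\<close>
lemma power_sum_bigo_zero:
  fixes w :: "nat \<Rightarrow> 'a::real_normed_vector"
  assumes "(\<lambda>t. norm (\<Sum>k<n. t ^ k *\<^sub>R w k)) \<in> O[at 0](\<lambda>t. t ^ n)" "k < n"
  shows "w k = 0"
  using assms
proof (induction n arbitrary: w k)
  case (Suc n)
  have lim_0: "((\<lambda>t. \<Sum>k<Suc n. t ^ k *\<^sub>R w k) \<longlongrightarrow> 0) (at 0)"
    using Suc.prems(1) by (rule bigo_tendsto_0) (auto intro!: tendsto_eq_intros)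
  have lim_w: "((\<lambda>t. \<Sum>k<Suc n. t ^ k *\<^sub>R w k) \<longlongrightarrow> (\<Sum>k<Suc n. 0 ^ k *\<^sub>R w k)) (at (0::real))"
    by (intro tendsto_intros)
  have "w 0 = (\<Sum>k<Suc n. 0 ^ k *\<^sub>R w k)"
    by (simp add: sum.lessThan_Suc_shift del: sum.lessThan_Suc)
  also have "\<dots> = 0" by (rule tendsto_unique[OF trivial_limit_at lim_w lim_0])
  finally have 0: "w 0 = 0" .
  have eq: "(\<Sum>k<Suc n. t ^ k *\<^sub>R w k) = t *\<^sub>R (\<Sum>k<n. t ^ k *\<^sub>R w (Suc k))" for t
    by (simp add: sum.lessThan_Suc_shift 0 scaleR_sum_right del: sum.lessThan_Suc)
  obtain c where "\<forall>\<^sub>F t in at 0. norm (norm (\<Sum>k<Suc n. t ^ k *\<^sub>R w k)) \<le> c * norm (t ^ Suc n)"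
    using Suc.prems(1) by (elim landau_o.bigE)
  moreover have "\<forall>\<^sub>F t in at 0. t \<noteq> (0::real)"
    by (auto simp: eventually_at_filter)
  ultimately have "\<forall>\<^sub>F t in at 0. norm (norm (\<Sum>k<n. t ^ k *\<^sub>R w (Suc k))) \<le> c * norm (t ^ n)"
  proof eventually_elim
    case (elim t)
    then have "\<bar>t\<bar> * norm (\<Sum>k<n. t ^ k *\<^sub>R w (Suc k)) \<le> \<bar>t\<bar> * (c * norm (t ^ n))"
      unfolding eq by (simp add: abs_mult mult_ac)
    moreover have "0 < \<bar>t\<bar>" using elim(2) by simp
    ultimately have "norm (\<Sum>k<n. t ^ k *\<^sub>R w (Suc k)) \<le> c * norm (t ^ n)"
      by (rule mult_left_le_imp_le)
    then show ?case by simp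
  qed
  then have "(\<lambda>t. norm (\<Sum>k<n. t ^ k *\<^sub>R w (Suc k))) \<in> O[at 0](\<lambda>t. t ^ n)"
    by (rule bigoI)
  then have "w (Suc j) = 0" if "j < n" for j
    using Suc.IH[of "\<lambda>k. w (Suc k)" j] that by simp
  with 0 Suc.prems(2) show ?case by (cases k) auto
next
  case 0
  from 0(2) show ?case by (rule less_zeroE)
qed

lemma has_jet_unique:
  assumes "has_jet f u" "has_jet f v" "k < 5"
  shows "u k = v k"
proof -
  have "has_jet (\<lambda>t. 0) (\<lambda>k. u k - v k)"
    using has_jet_add[OF assms(1) bounded_linear.has_jet[OF bounded_linear_minus[OF bounded_linear_ident] assms(2)]] by simp
  then have "u k - v k = 0"
    unfolding has_jet_def using assms(3) by (intro power_sum_bigo_zero[where n = 5 and w = "\<lambda>k. u k - v k"]) auto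
  then show ?thesis by simp
qed

lemma has_jet_bilinear:
  fixes f :: "'a::euclidean_space \<Rightarrow> 'b::euclidean_space \<Rightarrow> 'c::real_normed_vector"
  assumes "bilinear f" "has_jet p u" "has_jet q v"
  shows "has_jet (\<lambda>t. f (p t) (q t)) (\<lambda>k. \<Sum>i\<le>k. f (u i) (v (k - i)))"
  by (rule bounded_bilinear.has_jet[OF bilinear_conv_bounded_bilinear[THEN iffD1, OF assms(1)] assms(2,3)])

lemma has_jet_inner:
  assumes "has_jet p u" shows "has_jet (\<lambda>t. p t \<bullet> b) (\<lambda>k. u k \<bullet> b)"
  using bounded_linear.has_jet[OF bounded_linear_inner_left assms] .

lemma has_jet_scaleR:
  assumes "has_jet p u" "has_jet q v"
  shows "has_jet (\<lambda>t. p t *\<^sub>R q t) (\<lambda>k. \<Sum>i\<le>k. u i *\<^sub>R v (k - i))"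
  using bounded_bilinear.has_jet[OF bounded_bilinear_scaleR assms] .

text \<open>Expanding the first argument in the basis turns a multilinear expression into a sum of products of a
scalar curve with an expression of one argument fewer.\<close>
lemma has_jet_trilinear:
  fixes f :: "'a::euclidean_space \<Rightarrow> 'b::euclidean_space \<Rightarrow> 'c::euclidean_space \<Rightarrow> 'd::real_normed_vector"
  assumes f: "\<And>x. bilinear (f x)" "\<And>y z. linear (\<lambda>x. f x y z)"
    and p: "has_jet p u" and q: "has_jet q v" and r: "has_jet r w"
  shows "has_jet (\<lambda>t. f (p t) (q t) (r t)) (\<lambda>k. \<Sum>i\<le>k. \<Sum>j\<le>k - i. f (u i) (v j) (w (k - i - j)))"
proof -
  have eq: "f x y z = (\<Sum>b\<in>Basis. (x \<bullet> b) *\<^sub>R f b y z)" for x y z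
    using linear_Basis_sum[OF f(2)] .
  have 1: "has_jet (\<lambda>t. \<Sum>b\<in>Basis. (p t \<bullet> b) *\<^sub>R f b (q t) (r t))
    (\<lambda>k. \<Sum>b\<in>Basis. \<Sum>i\<le>k. (u i \<bullet> b) *\<^sub>R (\<Sum>j\<le>k - i. f b (v j) (w (k - i - j))))"
    by (rule has_jet_sum[OF has_jet_scaleR[OF has_jet_inner[OF p] has_jet_bilinear[OF f(1) q r]]])
  have 2: "(\<lambda>k. \<Sum>b\<in>Basis. \<Sum>i\<le>k. (u i \<bullet> b) *\<^sub>R (\<Sum>j\<le>k - i. f b (v j) (w (k - i - j)))) =
    (\<lambda>k. \<Sum>i\<le>k. \<Sum>j\<le>k - i. \<Sum>b\<in>Basis. (u i \<bullet> b) *\<^sub>R f b (v j) (w (k - i - j)))"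
    unfolding scaleR_sum_right by (rule ext, subst sum.swap, rule sum.cong[OF refl], rule sum.swap)
  show ?thesis using 1 unfolding 2 by (simp only: eq[symmetric])
qed

lemma has_jet_quadrilinear:
  fixes f :: "'a::euclidean_space \<Rightarrow> 'b::euclidean_space \<Rightarrow> 'c::euclidean_space \<Rightarrow> 'd::euclidean_space \<Rightarrow> 'e::real_normed_vector"
  assumes f: "\<And>x y. bilinear (f x y)" "\<And>x z w. linear (\<lambda>y. f x y z w)" "\<And>y z w. linear (\<lambda>x. f x y z w)"
    and p: "has_jet p u" and q: "has_jet q v" and r: "has_jet r w" and s: "has_jet s x"
  shows "has_jet (\<lambda>t. f (p t) (q t) (r t) (s t))
    (\<lambda>k. \<Sum>i\<le>k. \<Sum>j\<le>k - i. \<Sum>l\<le>k - i - j. f (u i) (v j) (w l) (x (k - i - j - l)))"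
proof -
  have eq: "f x y z a = (\<Sum>b\<in>Basis. (x \<bullet> b) *\<^sub>R f b y z a)" for x y z a
    using linear_Basis_sum[OF f(3)] .
  have 1: "has_jet (\<lambda>t. \<Sum>b\<in>Basis. (p t \<bullet> b) *\<^sub>R f b (q t) (r t) (s t))
    (\<lambda>k. \<Sum>b\<in>Basis. \<Sum>i\<le>k. (u i \<bullet> b) *\<^sub>R (\<Sum>j\<le>k - i. \<Sum>l\<le>k - i - j. f b (v j) (w l) (x (k - i - j - l))))"
    by (rule has_jet_sum[OF has_jet_scaleR[OF has_jet_inner[OF p] has_jet_trilinear[OF f(1,2) q r s]]])
  have 2: "(\<lambda>k. \<Sum>b\<in>Basis. \<Sum>i\<le>k. (u i \<bullet> b) *\<^sub>R (\<Sum>j\<le>k - i. \<Sum>l\<le>k - i - j. f b (v j) (w l) (x (k - i - j - l)))) =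
    (\<lambda>k. \<Sum>i\<le>k. \<Sum>j\<le>k - i. \<Sum>l\<le>k - i - j. \<Sum>b\<in>Basis. (u i \<bullet> b) *\<^sub>R f b (v j) (w l) (x (k - i - j - l)))"
    unfolding scaleR_sum_right by (rule ext, subst sum.swap, rule sum.cong[OF refl], subst sum.swap, rule sum.cong[OF refl], rule sum.swap)
  show ?thesis using 1 unfolding 2 by (simp only: eq[symmetric])
qed

text \<open>An expansion of \<open>G\<close> at 0 may be substituted along a curve through 0, because such a curve is
\<open>O(t)\<close>.\<close>
lemma has_jet_of_expansion:
  fixes G :: "'a::real_normed_vector \<Rightarrow> 'b::real_normed_vector"
  assumes "(\<lambda>z. norm (G z - H z)) \<in> O[nhds 0](\<lambda>z. norm z ^ 5)"
    and z: "has_jet z u" and u0: "u 0 = 0" and H: "has_jet (\<lambda>t. H (z t)) v"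
  shows "has_jet (\<lambda>t. G (z t)) v"
proof -
  have "filterlim z (nhds 0) (at 0)"
    using has_jet_tendsto[OF z] u0 by simp
  then have "(\<lambda>t. norm (G (z t) - H (z t))) \<in> O[at 0](\<lambda>t. norm (z t) ^ 5)"
    by (rule landau_o.big.compose[OF assms(1)])
  moreover have "(\<lambda>t. norm (z t) ^ 5) \<in> O[at 0](\<lambda>t. t ^ 5)"
  proof -
    have "(\<lambda>t. norm (z t)) \<in> O[at 0](\<lambda>t. t)"
    proof -
      have "(\<lambda>t. norm (z t - (\<Sum>k<5. t ^ k *\<^sub>R u k))) \<in> O[at 0](\<lambda>t. t)"
        using landau_o.big_trans[OF z[unfolded has_jet_def] power_bigo[of 1 5]] by simp
      moreover have "(\<lambda>t. norm (\<Sum>k<5. t ^ k *\<^sub>R u k)) \<in> O[at 0](\<lambda>t. t)"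
      proof -
        define w where "w t = (\<Sum>k<4. t ^ k *\<^sub>R u (Suc k))" for t
        have "(\<Sum>k<Suc 4. t ^ k *\<^sub>R u k) = t *\<^sub>R w t" for t
          unfolding sum.lessThan_Suc_shift w_def by (simp add: u0 scaleR_sum_right)
        then have eq: "norm (\<Sum>k<5. t ^ k *\<^sub>R u k) = norm (w t) * \<bar>t\<bar>" for t
          by simp
        have "(\<lambda>t. norm (w t)) \<in> O[at 0](\<lambda>_. 1)"
        proof (rule bigoI_tendsto)
          show "((\<lambda>t. norm (w t) / 1) \<longlongrightarrow> norm (\<Sum>k<4. 0 ^ k *\<^sub>R u (Suc k)) / 1) (at 0)"
            unfolding w_def by (intro tendsto_intros) auto
        qed auto
        from landau_o.big.mult[OF this, of "\<lambda>t. \<bar>t\<bar>" "\<lambda>t. t"] show ?thesis by (simp add: eq)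
      qed
      ultimately show ?thesis
        using norm_bigo_add by fastforce
    qed
    then show ?thesis by (rule landau_o.big_power)
  qed
  ultimately have "(\<lambda>t. norm (G (z t) - H (z t))) \<in> O[at 0](\<lambda>t. t ^ 5)"
    by (rule landau_o.big_trans)
  then have "has_jet (\<lambda>t. G (z t) - H (z t)) (\<lambda>k. 0)"
    by (simp add: has_jet_def)
  from has_jet_add[OF this H] show ?thesis by simp
qed

lemma has_jet_scaleR_const: "has_jet f u \<Longrightarrow> has_jet (\<lambda>t. c *\<^sub>R f t) (\<lambda>k. c *\<^sub>R u k)"
  by (rule bounded_linear.has_jet[OF bounded_linear_scaleR_right])

lemma has_jet_line: "has_jet (\<lambda>t. t *\<^sub>R z) (\<lambda>k. if k = 1 then z else 0)"
proof -
  have "(\<Sum>k<5. t ^ k *\<^sub>R (if k = 1 then z else 0)) = t *\<^sub>R z" for t :: real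
    by (simp add: eval_nat_numeral)
  then show ?thesis by (simp add: has_jet_def)
qed

section \<open>Taylor expansion of real-analytic functions\<close>

definition monom_at :: "'a::euclidean_space \<Rightarrow> ('a \<Rightarrow> nat) \<Rightarrow> real" where
  "monom_at z \<alpha> = (\<Prod>b\<in>Basis. (z \<bullet> b) ^ \<alpha> b)"

definition total_degree :: "('a::euclidean_space \<Rightarrow> nat) \<Rightarrow> nat" where
  "total_degree \<alpha> = (\<Sum>b\<in>Basis. \<alpha> b)"

lemma abs_monom_at_le: "\<bar>monom_at z \<alpha>\<bar> \<le> norm z ^ total_degree \<alpha>"
proof -
  have "\<bar>monom_at z \<alpha>\<bar> = (\<Prod>b\<in>Basis. \<bar>z \<bullet> b\<bar> ^ \<alpha> b)"
    by (simp add: monom_at_def abs_prod power_abs)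
  also have "\<dots> \<le> (\<Prod>b\<in>Basis. norm z ^ \<alpha> b)"
    by (intro prod_mono) (auto intro!: power_mono simp: Basis_le_norm)
  finally show ?thesis by (simp add: total_degree_def power_sum)
qed

lemma finite_total_degree_less: "finite {\<alpha> \<in> multi_indices. total_degree (\<alpha> :: 'a::euclidean_space \<Rightarrow> nat) < n}"
proof (rule finite_subset)
  show "finite {\<alpha> :: 'a \<Rightarrow> nat. \<forall>b. (b \<in> Basis \<longrightarrow> \<alpha> b \<in> {..<n}) \<and> (b \<notin> Basis \<longrightarrow> \<alpha> b = 0)}"
    by (intro finite_set_of_finite_funs) auto
  have "\<alpha> b < n" if "total_degree \<alpha> < n" "b \<in> Basis" for \<alpha> and b :: 'a
    using that member_le_sum[OF that(2), of \<alpha>] by (auto simp: total_degree_def)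
  then show "{\<alpha> \<in> multi_indices. total_degree \<alpha> < n} \<subseteq>
      {\<alpha> :: 'a \<Rightarrow> nat. \<forall>b. (b \<in> Basis \<longrightarrow> \<alpha> b \<in> {..<n}) \<and> (b \<notin> Basis \<longrightarrow> \<alpha> b = 0)}"
    by (auto simp: multi_indices_def)
qed

text \<open>At the point all of whose coordinates equal \<open>s\<close>, the series converges absolutely, with terms
of norm \<open>G \<alpha>\<close>. For \<open>norm z < s\<close> a term of degree \<open>k \<ge> n\<close> has norm at most \<open>(norm z / s)\<^sup>k G \<alpha> \<le> (norm z / s)\<^sup>n G \<alpha>\<close>, so
the tail is bounded by \<open>(norm z / s)\<^sup>n\<close> times a constant.\<close>
lemma power_series_tail:
  fixes f :: "'a::euclidean_space \<Rightarrow> 'b::euclidean_space"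
  assumes r: "r > 0"
    and sum: "\<And>z. norm z < r \<Longrightarrow> ((\<lambda>\<alpha>. monom_at z \<alpha> *\<^sub>R c \<alpha>) has_sum f z) multi_indices"
  shows "(\<lambda>z. norm (f z - (\<Sum>\<alpha> | \<alpha> \<in> multi_indices \<and> total_degree \<alpha> < n. monom_at z \<alpha> *\<^sub>R c \<alpha>)))
    \<in> O[nhds 0](\<lambda>z. norm z ^ n)"
proof -
  define s where "s = r / (2 * DIM('a))"
  \<comment> \<open>All coordinates of \<open>z\<^sub>0\<close> equal \<open>s\<close>, and the norm of \<open>One\<close> is at most the dimension.\<close>
  define z\<^sub>0 :: 'a where "z\<^sub>0 = s *\<^sub>R One"
  have s: "s > 0" using r by (simp add: s_def)
  have "norm (One :: 'a) \<le> (\<Sum>b\<in>(Basis::'a set). norm b)" by (rule norm_sum)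
  then have "norm (One :: 'a) \<le> DIM('a)" by simp
  then have "norm z\<^sub>0 \<le> s * DIM('a)" using s by (simp add: z\<^sub>0_def)
  also have "\<dots> < r" using r by (simp add: s_def)
  finally have z\<^sub>0: "norm z\<^sub>0 < r" .
  have mz\<^sub>0: "monom_at z\<^sub>0 \<alpha> = s ^ total_degree \<alpha>" for \<alpha>
    by (simp add: monom_at_def z\<^sub>0_def total_degree_def power_sum)
  define G where "G \<alpha> = s ^ total_degree \<alpha> * norm (c \<alpha>)" for \<alpha> :: "'a \<Rightarrow> nat"
  have G: "G summable_on multi_indices"
  proof (rule summable_on_comparison_test)
    have "(\<lambda>\<alpha>. (s ^ total_degree \<alpha> *\<^sub>R c \<alpha>) \<bullet> i) summable_on multi_indices" for i
      using has_sum_imp_summable[OF sum[OF z\<^sub>0]] unfolding mz\<^sub>0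
      by (rule summable_on_bounded_linear[OF bounded_linear_inner_left])
    then have "(\<lambda>\<alpha>. \<bar>(s ^ total_degree \<alpha> *\<^sub>R c \<alpha>) \<bullet> i\<bar>) summable_on multi_indices" for i
      by (subst (asm) summable_on_iff_abs_summable_on_real) simp
    then show "(\<lambda>\<alpha>. \<Sum>i\<in>Basis. \<bar>(s ^ total_degree \<alpha> *\<^sub>R c \<alpha>) \<bullet> i\<bar>) summable_on multi_indices"
      by (induction rule: finite_induct[OF finite_Basis]) (simp_all add: summable_on_add)
    show "G \<alpha> \<le> (\<Sum>i\<in>Basis. \<bar>(s ^ total_degree \<alpha> *\<^sub>R c \<alpha>) \<bullet> i\<bar>)" for \<alpha>
      using norm_le_l1[of "s ^ total_degree \<alpha> *\<^sub>R c \<alpha>"] s by (simp add: G_def)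
    show "0 \<le> G \<alpha>" for \<alpha> using s by (simp add: G_def)
  qed
  define H where "H = {\<alpha> \<in> multi_indices. \<not> total_degree (\<alpha> :: 'a \<Rightarrow> nat) < n}"
  define L where "L = {\<alpha> \<in> multi_indices. total_degree (\<alpha> :: 'a \<Rightarrow> nat) < n}"
  have "norm (f z - (\<Sum>\<alpha>\<in>L. monom_at z \<alpha> *\<^sub>R c \<alpha>)) \<le> (infsum G H / s ^ n) * norm z ^ n"
    if z: "norm z < r" "norm z < s" for z
  proof -
    have fin: "finite L" unfolding L_def by (rule finite_total_degree_less)
    have "((\<lambda>\<alpha>. monom_at z \<alpha> *\<^sub>R c \<alpha>) has_sum (f z - (\<Sum>\<alpha>\<in>L. monom_at z \<alpha> *\<^sub>R c \<alpha>))) (multi_indices - L)"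
      using sum[OF z(1)] has_sum_finite[OF fin] by (rule has_sum_Diff) (auto simp: L_def)
    also have "multi_indices - L = H" by (auto simp: L_def H_def)
    finally have tail: "((\<lambda>\<alpha>. monom_at z \<alpha> *\<^sub>R c \<alpha>) has_sum (f z - (\<Sum>\<alpha>\<in>L. monom_at z \<alpha> *\<^sub>R c \<alpha>))) H" .
    have "G summable_on H" using G by (rule summable_on_subset_banach) (auto simp: H_def)
    then have "((\<lambda>\<alpha>. (norm z / s) ^ n * G \<alpha>) has_sum ((norm z / s) ^ n * infsum G H)) H"
      by (intro has_sum_cmult_right has_sum_infsum)
    with tail have "norm (f z - (\<Sum>\<alpha>\<in>L. monom_at z \<alpha> *\<^sub>R c \<alpha>)) \<le> (norm z / s) ^ n * infsum G H"
    proof (rule norm_infsum_le)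
      fix \<alpha> assume "\<alpha> \<in> H"
      then have deg: "n \<le> total_degree \<alpha>" by (simp add: H_def)
      have "norm (monom_at z \<alpha> *\<^sub>R c \<alpha>) \<le> norm z ^ total_degree \<alpha> * norm (c \<alpha>)"
        by (simp add: mult_right_mono abs_monom_at_le)
      also have "\<dots> = (norm z / s) ^ total_degree \<alpha> * G \<alpha>"
        using s by (simp add: G_def power_divide)
      also have "\<dots> \<le> (norm z / s) ^ n * G \<alpha>"
        using s z deg by (intro mult_right_mono power_decreasing) (auto simp: G_def)
      finally show "norm (monom_at z \<alpha> *\<^sub>R c \<alpha>) \<le> (norm z / s) ^ n * G \<alpha>" .
    qed
    then show ?thesis by (simp add: power_divide mult_ac)
  qed
  moreover have "\<forall>\<^sub>F z in nhds 0. norm (z :: 'a) < min r s"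
    using r s eventually_nhds_in_open[of "ball 0 (min r s)" "0::'a"] by (auto elim!: eventually_mono)
  ultimately show ?thesis
    unfolding L_def by (intro bigoI[where c = "infsum G H / s ^ n"]) (auto elim!: eventually_mono)
qed

text \<open>Words of length \<open>k\<close> in the basis vectors index the coefficients of a \<open>k\<close>-linear map, as multi-indices
of degree \<open>k\<close> index those of a homogeneous polynomial. A word has \<open>count_list\<close> as its multi-index.\<close>
definition basis_words :: "nat \<Rightarrow> 'a::euclidean_space list set" where
  "basis_words k = {bs. set bs \<subseteq> Basis \<and> length bs = k}"

lemma finite_basis_words: "finite (basis_words k)"
  unfolding basis_words_def by (rule finite_lists_length_eq) simp

lemma basis_words_Suc: "basis_words (Suc k) = (\<lambda>(b, bs). b # bs) ` (Basis \<times> basis_words k)"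
  by (auto simp: basis_words_def length_Suc_conv image_iff)

lemma sum_basis_words_0:
  fixes h :: "'a::euclidean_space list \<Rightarrow> 'b::comm_monoid_add"
  shows "sum h (basis_words 0) = h []"
proof -
  have "basis_words 0 = {[] :: 'a list}" by (auto simp: basis_words_def)
  then show ?thesis by simp
qed

lemma sum_basis_words_Suc: "sum h (basis_words (Suc k)) = (\<Sum>b\<in>Basis. \<Sum>bs\<in>basis_words k. h (b # bs))"
  unfolding basis_words_Suc sum.cartesian_product
  by (subst sum.reindex) (auto simp: inj_on_def case_prod_unfold)

lemma count_list_basis_word:
  assumes "bs \<in> basis_words k"
  shows "count_list bs \<in> multi_indices" "total_degree (count_list bs) = k"
    "monom_at z (count_list bs) = (\<Prod>b\<leftarrow>bs. z \<bullet> b)"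
proof -
  have "count_list bs \<in> multi_indices \<and> total_degree (count_list bs) = k \<and>
    monom_at z (count_list bs) = (\<Prod>b\<leftarrow>bs. z \<bullet> b)"
    using assms
  proof (induction k arbitrary: bs)
    case 0
    then show ?case by (auto simp: basis_words_def multi_indices_def total_degree_def monom_at_def)
  next
    case (Suc k)
    then obtain b bs' where bs: "bs = b # bs'" "b \<in> Basis" "bs' \<in> basis_words k"
      by (auto simp: basis_words_Suc)
    have "count_list bs = (\<lambda>b'. count_list bs' b' + (if b' = b then 1 else 0))"
      by (auto simp: bs)
    then show ?case
      using Suc.IH[OF bs(3)] bs(1,2)
      by (auto simp: multi_indices_def total_degree_def monom_at_def sum.distrib power_add prod.distrib
          if_distrib[of "\<lambda>n. _ ^ n"] cong: if_cong)
  qed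
  then show "count_list bs \<in> multi_indices" "total_degree (count_list bs) = k"
    "monom_at z (count_list bs) = (\<Prod>b\<leftarrow>bs. z \<bullet> b)" by blast+
qed

lemma ex_basis_word:
  assumes "\<alpha> \<in> multi_indices" "total_degree \<alpha> = k"
  shows "\<exists>bs\<in>basis_words k. count_list bs = \<alpha>"
  using assms
proof (induction k arbitrary: \<alpha>)
  case 0
  then have "\<alpha> = count_list []" by (auto simp: multi_indices_def total_degree_def fun_eq_iff)
  then show ?case by (auto simp: basis_words_def)
next
  case (Suc k)
  then have "(\<Sum>b\<in>Basis. \<alpha> b) \<noteq> 0" by (simp add: total_degree_def)
  then obtain b where "b \<in> Basis" "\<alpha> b \<noteq> 0" by (rule sum.not_neutral_contains_not_neutral)
  then have b: "b \<in> Basis" "\<alpha> b > 0" by simp_all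
  define \<beta> where "\<beta> = \<alpha>(b := \<alpha> b - 1)"
  have "total_degree \<alpha> = \<alpha> b + (\<Sum>b'\<in>Basis - {b}. \<alpha> b')"
    using b by (simp add: total_degree_def sum.remove)
  moreover have "total_degree \<beta> = \<beta> b + (\<Sum>b'\<in>Basis - {b}. \<beta> b')"
    using b by (simp add: total_degree_def sum.remove)
  moreover have "(\<Sum>b'\<in>Basis - {b}. \<beta> b') = (\<Sum>b'\<in>Basis - {b}. \<alpha> b')"
    by (intro sum.cong) (auto simp: \<beta>_def)
  ultimately have "total_degree \<beta> = k" using Suc.prems b by (simp add: \<beta>_def)
  moreover have "\<beta> \<in> multi_indices" using Suc.prems b by (auto simp: \<beta>_def multi_indices_def)
  ultimately obtain bs where bs: "bs \<in> basis_words k" "count_list bs = \<beta>" using Suc.IH by blast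
  then have "count_list (b # bs) = \<alpha>" using b by (auto simp: \<beta>_def fun_eq_iff)
  moreover have "b # bs \<in> basis_words (Suc k)" using bs b by (simp add: basis_words_def)
  ultimately show ?case by blast
qed

text \<open>A monomial coefficient is spread evenly over all words with that multi-index. The result depends only
on the multi-index of the word, which makes the multilinear maps built from it symmetric.\<close>
definition symmetric_coeff :: "(('a::euclidean_space \<Rightarrow> nat) \<Rightarrow> 'b::real_vector) \<Rightarrow> 'a list \<Rightarrow> 'b" where
  "symmetric_coeff c bs =
    c (count_list bs) /\<^sub>R card {bs' \<in> basis_words (length bs). count_list bs' = count_list bs}"

lemma homogeneous_part_eq:
  fixes z :: "'a::euclidean_space"
  shows
  "(\<Sum>\<alpha> | \<alpha> \<in> multi_indices \<and> total_degree \<alpha> = k. monom_at z \<alpha> *\<^sub>R c \<alpha>) =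
   (\<Sum>bs\<in>basis_words k. (\<Prod>b\<leftarrow>bs. z \<bullet> b) *\<^sub>R symmetric_coeff c bs)"
proof -
  let ?I = "{\<alpha> :: 'a \<Rightarrow> nat. \<alpha> \<in> multi_indices \<and> total_degree \<alpha> = k}"
  have fin: "finite ?I"
    by (rule finite_subset[OF _ finite_total_degree_less[of "Suc k"]]) auto
  have "(\<Sum>bs\<in>basis_words k. (\<Prod>b\<leftarrow>bs. z \<bullet> b) *\<^sub>R symmetric_coeff c bs) =
    (\<Sum>\<alpha>\<in>?I. \<Sum>bs | bs \<in> basis_words k \<and> count_list bs = \<alpha>. (\<Prod>b\<leftarrow>bs. z \<bullet> b) *\<^sub>R symmetric_coeff c bs)"
    by (rule sum.group[symmetric]) (auto simp: finite_basis_words fin count_list_basis_word)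
  also have "\<dots> = (\<Sum>\<alpha>\<in>?I. monom_at z \<alpha> *\<^sub>R c \<alpha>)"
  proof (rule sum.cong)
    fix \<alpha> assume \<alpha>: "\<alpha> \<in> ?I"
    let ?W = "{bs. (bs :: 'a list) \<in> basis_words k \<and> count_list bs = \<alpha>}"
    have "(\<Sum>bs\<in>?W. (\<Prod>b\<leftarrow>bs. z \<bullet> b) *\<^sub>R symmetric_coeff c bs) =
      (\<Sum>bs\<in>?W. monom_at z \<alpha> *\<^sub>R (c \<alpha> /\<^sub>R card ?W))"
    proof (rule sum.cong)
      fix bs assume "bs \<in> ?W"
      then show "(\<Prod>b\<leftarrow>bs. z \<bullet> b) *\<^sub>R symmetric_coeff c bs = monom_at z \<alpha> *\<^sub>R (c \<alpha> /\<^sub>R card ?W)"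
        using count_list_basis_word(3)[of bs k z] by (auto simp: symmetric_coeff_def basis_words_def)
    qed simp
    also have "card ?W \<noteq> 0"
      using ex_basis_word[of \<alpha> k] \<alpha> finite_subset[OF _ finite_basis_words[of k], of ?W] by (auto simp: card_eq_0_iff)
    then have "(\<Sum>bs\<in>?W. monom_at z \<alpha> *\<^sub>R (c \<alpha> /\<^sub>R card ?W)) = monom_at z \<alpha> *\<^sub>R c \<alpha>"
      by (simp add: sum_constant_scaleR)
    finally show "(\<Sum>bs\<in>?W. (\<Prod>b\<leftarrow>bs. z \<bullet> b) *\<^sub>R symmetric_coeff c bs) = monom_at z \<alpha> *\<^sub>R c \<alpha>" .
  qed simp
  finally show ?thesis by simp
qed

lemma symmetric_coeff_swap:
  "symmetric_coeff c [a, b] = symmetric_coeff c [b, a]"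
  "symmetric_coeff c [a, b, d] = symmetric_coeff c [b, a, d]"
  "symmetric_coeff c [a, b, d] = symmetric_coeff c [a, d, b]"
  "symmetric_coeff c [a, b, d, e] = symmetric_coeff c [b, a, d, e]"
  "symmetric_coeff c [a, b, d, e] = symmetric_coeff c [a, d, b, e]"
  "symmetric_coeff c [a, b, d, e] = symmetric_coeff c [a, b, e, d]"
proof -
  have eq: "symmetric_coeff c bs = symmetric_coeff c bs'" if "mset bs = mset bs'" for bs bs'
  proof -
    have "length bs = length bs'" using that by (rule mset_eq_length)
    moreover have "count_list bs = count_list bs'" using that by (metis count_mset ext)
    ultimately show ?thesis by (simp add: symmetric_coeff_def)
  qed
  show "symmetric_coeff c [a, b] = symmetric_coeff c [b, a]"
  "symmetric_coeff c [a, b, d] = symmetric_coeff c [b, a, d]"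
  "symmetric_coeff c [a, b, d] = symmetric_coeff c [a, d, b]"
  "symmetric_coeff c [a, b, d, e] = symmetric_coeff c [b, a, d, e]"
  "symmetric_coeff c [a, b, d, e] = symmetric_coeff c [a, d, b, e]"
  "symmetric_coeff c [a, b, d, e] = symmetric_coeff c [a, b, e, d]"
    by (rule eq, simp add: add_mset_commute)+
qed


text \<open>The homogeneous parts are written as diagonals of symmetric multilinear maps; the later
comparison of coefficients is multilinear algebra with these maps.\<close>
lemma real_analytic_expansion:
  fixes f :: "'a::euclidean_space \<Rightarrow> 'b::euclidean_space"
  assumes "real_analytic_at f p"
  obtains M\<^sub>0 M\<^sub>1 M\<^sub>2 M\<^sub>3 M\<^sub>4 where
    "linear M\<^sub>1" "bilinear M\<^sub>2" "trilinear M\<^sub>3" "quadrilinear M\<^sub>4"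
    "\<And>x y. M\<^sub>2 x y = M\<^sub>2 y x"
    "\<And>x y z. M\<^sub>3 x y z = M\<^sub>3 y x z" "\<And>x y z. M\<^sub>3 x y z = M\<^sub>3 x z y"
    "\<And>x y z w. M\<^sub>4 x y z w = M\<^sub>4 y x z w" "\<And>x y z w. M\<^sub>4 x y z w = M\<^sub>4 x z y w"
    "\<And>x y z w. M\<^sub>4 x y z w = M\<^sub>4 x y w z"
    "(\<lambda>z. norm (f (p + z) - (M\<^sub>0 + M\<^sub>1 z + M\<^sub>2 z z + M\<^sub>3 z z z + M\<^sub>4 z z z z))) \<in> O[nhds 0](\<lambda>z. norm z ^ 5)"
proof -
  obtain c r where r: "r > 0" and sum: "\<forall>x\<in>ball p r.
      ((\<lambda>\<alpha>. (\<Prod>b\<in>Basis. ((x - p) \<bullet> b) ^ \<alpha> b) *\<^sub>R c \<alpha>) has_sum f x) multi_indices"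
    using assms unfolding real_analytic_at_def by blast
  define d where "d = symmetric_coeff c"
  define M\<^sub>0 where "M\<^sub>0 = d []"
  define M\<^sub>1 where "M\<^sub>1 x = (\<Sum>a\<in>Basis. (x \<bullet> a) *\<^sub>R d [a])" for x
  define M\<^sub>2 where "M\<^sub>2 x y = (\<Sum>a\<in>Basis. \<Sum>b\<in>Basis. ((x \<bullet> a) * (y \<bullet> b)) *\<^sub>R d [a, b])" for x y
  define M\<^sub>3 where "M\<^sub>3 x y z = (\<Sum>a\<in>Basis. \<Sum>b\<in>Basis. \<Sum>e\<in>Basis.
    ((x \<bullet> a) * (y \<bullet> b) * (z \<bullet> e)) *\<^sub>R d [a, b, e])" for x y z
  define M\<^sub>4 where "M\<^sub>4 x y z w = (\<Sum>a\<in>Basis. \<Sum>b\<in>Basis. \<Sum>e\<in>Basis. \<Sum>g\<in>Basis.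
    ((x \<bullet> a) * (y \<bullet> b) * (z \<bullet> e) * (w \<bullet> g)) *\<^sub>R d [a, b, e, g])" for x y z w
  note d_swap = symmetric_coeff_swap[of c, folded d_def]
  have swap_cong: "(\<Sum>a\<in>Basis. \<Sum>b\<in>Basis. F a b) = (\<Sum>a\<in>Basis. \<Sum>b\<in>Basis. G a b)"
    if "\<And>a b. F a b = G b a" for F G :: "'a \<Rightarrow> 'a \<Rightarrow> 'b"
    using sum.swap[of F Basis Basis] by (simp add: that)
  have lin: "linear M\<^sub>1"
    by (auto intro!: linearI simp: M\<^sub>1_def inner_add_left scaleR_add_left sum.distrib scaleR_sum_right)
  have M\<^sub>2_sym: "M\<^sub>2 x y = M\<^sub>2 y x" for x y
    unfolding M\<^sub>2_def by (rule swap_cong) (simp add: d_swap(1) mult.commute)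
  have M\<^sub>3_sym: "M\<^sub>3 x y z = M\<^sub>3 y x z" "M\<^sub>3 x y z = M\<^sub>3 x z y" for x y z
    unfolding M\<^sub>3_def
    by (rule swap_cong, rule sum.cong, simp, subst d_swap(2), simp add: mult_ac)
       (rule sum.cong, simp, rule swap_cong, subst d_swap(3), simp add: mult_ac)
  have M\<^sub>4_sym: "M\<^sub>4 x y z w = M\<^sub>4 y x z w" "M\<^sub>4 x y z w = M\<^sub>4 x z y w" "M\<^sub>4 x y z w = M\<^sub>4 x y w z" for x y z w
    unfolding M\<^sub>4_def
    by (rule swap_cong, rule sum.cong, simp, rule sum.cong, simp, subst d_swap(4), simp add: mult_ac)
       (rule sum.cong, simp, rule swap_cong, rule sum.cong, simp, subst d_swap(5), simp add: mult_ac,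
        rule sum.cong, simp, rule sum.cong, simp, rule swap_cong, subst d_swap(6), simp add: mult_ac)
  have lin2: "linear (\<lambda>x. M\<^sub>2 x y)" for y
    by (rule linearI) (simp_all add: M\<^sub>2_def inner_add_left scaleR_add_left distrib_right sum.distrib
        scaleR_sum_right mult.assoc)
  have lin3: "linear (\<lambda>x. M\<^sub>3 x y z)" for y z
    by (rule linearI) (simp_all add: M\<^sub>3_def inner_add_left scaleR_add_left distrib_right sum.distrib
        scaleR_sum_right mult.assoc)
  have lin4: "linear (\<lambda>x. M\<^sub>4 x y z w)" for y z w
    by (rule linearI) (simp_all add: M\<^sub>4_def inner_add_left scaleR_add_left distrib_right sum.distrib
        scaleR_sum_right mult.assoc)
  have "linear (\<lambda>y. M\<^sub>2 x y)" for x by (subst M\<^sub>2_sym) (rule lin2)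
  with lin2 have "bilinear M\<^sub>2" by (simp add: bilinear_def)
  moreover have "trilinear M\<^sub>3"
  proof -
    have "linear (\<lambda>y. M\<^sub>3 x y z)" for x z by (subst M\<^sub>3_sym) (rule lin3)
    moreover from this have "linear (\<lambda>z. M\<^sub>3 x y z)" for x y by (subst M\<^sub>3_sym(2))
    ultimately show ?thesis using lin3 by (simp add: trilinear_def bilinear_def)
  qed
  moreover have "quadrilinear M\<^sub>4"
  proof -
    have 1: "linear (\<lambda>y. M\<^sub>4 x y z w)" for x z w by (subst M\<^sub>4_sym) (rule lin4)
    have 2: "linear (\<lambda>z. M\<^sub>4 x y z w)" for x y w by (subst M\<^sub>4_sym(2)) (rule 1)
    have 3: "linear (\<lambda>w. M\<^sub>4 x y z w)" for x y z by (subst M\<^sub>4_sym(3)) (rule 2)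
    show ?thesis using lin4 1 2 3 by (simp add: quadrilinear_def trilinear_def bilinear_def)
  qed
  moreover have "(\<lambda>z. norm (f (p + z) - (M\<^sub>0 + M\<^sub>1 z + M\<^sub>2 z z + M\<^sub>3 z z z + M\<^sub>4 z z z z))) \<in> O[nhds 0](\<lambda>z. norm z ^ 5)"
  proof -
    have sum': "((\<lambda>\<alpha>. monom_at z \<alpha> *\<^sub>R c \<alpha>) has_sum f (p + z)) multi_indices" if "norm z < r" for z
      using sum[rule_format, of "p + z"] that by (simp add: monom_at_def dist_norm)
    have low: "(\<Sum>\<alpha> | \<alpha> \<in> multi_indices \<and> total_degree \<alpha> < n. monom_at z \<alpha> *\<^sub>R c \<alpha>) =
      (\<Sum>k<n. \<Sum>bs\<in>basis_words k. (\<Prod>b\<leftarrow>bs. z \<bullet> b) *\<^sub>R d bs)" for z :: 'a and n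
    proof -
      have "(\<Sum>\<alpha> | \<alpha> \<in> multi_indices \<and> total_degree \<alpha> < n. monom_at z \<alpha> *\<^sub>R c \<alpha>) =
        (\<Sum>k<n. \<Sum>\<alpha> | \<alpha> \<in> {\<alpha>. \<alpha> \<in> multi_indices \<and> total_degree \<alpha> < n} \<and> total_degree \<alpha> = k. monom_at z \<alpha> *\<^sub>R c \<alpha>)"
        by (rule sum.group[symmetric]) (auto simp: finite_total_degree_less)
      also have "\<dots> = (\<Sum>k<n. \<Sum>\<alpha> | \<alpha> \<in> multi_indices \<and> total_degree \<alpha> = k. monom_at z \<alpha> *\<^sub>R c \<alpha>)"
        by (intro sum.cong) auto
      finally show ?thesis by (simp add: homogeneous_part_eq d_def)
    qed
    have "(\<Sum>k<5. \<Sum>bs\<in>basis_words k. (\<Prod>b\<leftarrow>bs. z \<bullet> b) *\<^sub>R d bs) =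
      M\<^sub>0 + M\<^sub>1 z + M\<^sub>2 z z + M\<^sub>3 z z z + M\<^sub>4 z z z z" for z
      by (simp add: eval_nat_numeral sum_basis_words_0 sum_basis_words_Suc M\<^sub>0_def M\<^sub>1_def M\<^sub>2_def M\<^sub>3_def M\<^sub>4_def mult_ac)
    then show ?thesis
      using power_series_tail[OF r sum', of 5] by (simp only: low)
  qed
  ultimately show thesis
    using that lin M\<^sub>2_sym M\<^sub>3_sym M\<^sub>4_sym by blast
qed

lemma norm_power_bigo:
  assumes "m \<le> n" shows "(\<lambda>z::'a::real_normed_vector. norm z ^ n) \<in> O[nhds 0](\<lambda>z. norm z ^ m)"
proof (rule bigoI[where c = 1])
  have "\<forall>\<^sub>F z in nhds 0. norm (z::'a) < 1"
    using eventually_nhds_in_open[of "ball 0 1" "0::'a"] by (auto elim!: eventually_mono)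
  then show "\<forall>\<^sub>F z in nhds 0. norm (norm z ^ n) \<le> 1 * norm (norm (z::'a) ^ m)"
    by eventually_elim (use assms in \<open>simp add: power_decreasing\<close>)
qed

lemma real_analytic_imp_differentiable:
  fixes f :: "'a::euclidean_space \<Rightarrow> 'b::euclidean_space"
  assumes "real_analytic_at f p"
  shows "f differentiable (at p)"
proof -
  from assms obtain M\<^sub>0 M\<^sub>1 M\<^sub>2 M\<^sub>3 M\<^sub>4 where lin: "linear M\<^sub>1" "bilinear M\<^sub>2" "trilinear M\<^sub>3" "quadrilinear M\<^sub>4"
    and big: "(\<lambda>z. norm (f (p + z) - (M\<^sub>0 + M\<^sub>1 z + M\<^sub>2 z z + M\<^sub>3 z z z + M\<^sub>4 z z z z))) \<in> O[nhds 0](\<lambda>z. norm z ^ 5)"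
    by (elim real_analytic_expansion) (rule that)
  obtain K\<^sub>2 where K\<^sub>2: "\<And>x y. norm (M\<^sub>2 x y) \<le> norm x * norm y * K\<^sub>2"
    using bounded_bilinear.bounded[OF bilinear_conv_bounded_bilinear[THEN iffD1, OF lin(2)]] by blast
  obtain K\<^sub>3 where K\<^sub>3: "\<And>x y z. norm (M\<^sub>3 x y z) \<le> K\<^sub>3 * norm x * norm y * norm z"
    using trilinear_bound[OF lin(3)] by blast
  obtain K\<^sub>4 where K\<^sub>4: "\<And>x y z w. norm (M\<^sub>4 x y z w) \<le> K\<^sub>4 * norm x * norm y * norm z * norm w"
    using quadrilinear_bound[OF lin(4)] by blast
  have 2: "(\<lambda>z. norm (M\<^sub>2 z z)) \<in> O[nhds 0](\<lambda>z. norm z ^ 2)"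
    using K\<^sub>2 by (intro bigoI[where c = K\<^sub>2] always_eventually) (auto simp: power2_eq_square mult_ac)
  have "(\<lambda>z. norm (M\<^sub>3 z z z)) \<in> O[nhds 0](\<lambda>z. norm z ^ 3)"
    using K\<^sub>3 by (intro bigoI[where c = K\<^sub>3] always_eventually) (auto simp: power3_eq_cube mult_ac)
  then have 3: "(\<lambda>z. norm (M\<^sub>3 z z z)) \<in> O[nhds 0](\<lambda>z. norm z ^ 2)"
    using norm_power_bigo[of 2 3] by (rule landau_o.big_trans) simp
  have "(\<lambda>z. norm (M\<^sub>4 z z z z)) \<in> O[nhds 0](\<lambda>z. norm z ^ 4)"
    using K\<^sub>4 by (intro bigoI[where c = K\<^sub>4] always_eventually) (auto simp: power4_eq_xxxx mult_ac)
  then have 4: "(\<lambda>z. norm (M\<^sub>4 z z z z)) \<in> O[nhds 0](\<lambda>z. norm z ^ 2)"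
    using norm_power_bigo[of 2 4] by (rule landau_o.big_trans) simp
  have 5: "(\<lambda>z. norm (f (p + z) - (M\<^sub>0 + M\<^sub>1 z + M\<^sub>2 z z + M\<^sub>3 z z z + M\<^sub>4 z z z z))) \<in> O[nhds 0](\<lambda>z. norm z ^ 2)"
    using big norm_power_bigo[of 2 5] by (rule landau_o.big_trans) simp
  have "(\<lambda>z. norm (f (p + z) - (M\<^sub>0 + M\<^sub>1 z + M\<^sub>2 z z + M\<^sub>3 z z z + M\<^sub>4 z z z z) + M\<^sub>2 z z + M\<^sub>3 z z z + M\<^sub>4 z z z z))
    \<in> O[nhds 0](\<lambda>z. norm z ^ 2)"
    by (intro norm_bigo_add 2 3 4 5)
  then obtain C where C: "\<forall>\<^sub>F z in nhds 0. norm (f (p + z) - M\<^sub>0 - M\<^sub>1 z) \<le> C * norm z ^ 2"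
    by (elim landau_o.bigE) (simp add: algebra_simps)
  have M\<^sub>0: "M\<^sub>0 = f p" using eventually_nhds_x_imp_x[OF C] lin(1) by (simp add: linear_0)
  have "\<forall>\<^sub>F z in at 0. norm (norm (f (p + z) - f p - M\<^sub>1 z) / norm z) \<le> C * norm z"
    using C unfolding eventually_at_filter M\<^sub>0
    by eventually_elim (auto simp: divide_le_eq power2_eq_square mult_ac)
  moreover have "((\<lambda>z. C * norm z) \<longlongrightarrow> 0) (at (0::'a))"
    by (auto intro!: tendsto_eq_intros)
  ultimately have "((\<lambda>z. norm (f (p + z) - f p - M\<^sub>1 z) / norm z) \<longlongrightarrow> 0) (at 0)"
    by (rule Lim_null_comparison)
  then have "(f has_derivative M\<^sub>1) (at p)"
    using lin(1) by (simp add: has_derivative_at linear_linear)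
  then show ?thesis by (rule differentiableI)
qed

section \<open>Fourth-order jets of loop multiplications\<close>

text \<open>The Jacobian \<open>J(x,y,z)\<close> of a bracket; it measures the failure of the Jacobi identity.\<close>
definition Jacobi_sum :: "('a::ab_group_add \<Rightarrow> 'a \<Rightarrow> 'a) \<Rightarrow> 'a \<Rightarrow> 'a \<Rightarrow> 'a \<Rightarrow> 'a" where
  "Jacobi_sum br x y z = br (br x y) z + br (br y z) x + br (br z x) y"

text \<open>The maps are the mixed partial derivatives at the origin of a multiplication \<open>F\<close> with unit 0: with
\<open>D\<^sub>1, D\<^sub>2\<close> for differentiation in the first and second factor, \<open>B = D\<^sub>1 D\<^sub>2 F\<close>, \<open>P = D\<^sub>1\<^sup>2 D\<^sub>2 F\<close>, \<open>Q = D\<^sub>1 D\<^sub>2\<^sup>2 F\<close>,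
\<open>R = D\<^sub>1\<^sup>3 D\<^sub>2 F\<close>, \<open>S = D\<^sub>1\<^sup>2 D\<^sub>2\<^sup>2 F\<close>, \<open>T = D\<^sub>1 D\<^sub>2\<^sup>3 F\<close>. The pure derivatives of order at least two vanish
because \<open>F(x,0) = x\<close> and \<open>F(0,y) = y\<close>.\<close>
locale loop_jet =
  fixes B :: "real ^ 'n \<Rightarrow> real ^ 'n \<Rightarrow> real ^ 'n"
    and P Q :: "real ^ 'n \<Rightarrow> real ^ 'n \<Rightarrow> real ^ 'n \<Rightarrow> real ^ 'n"
    and R S T :: "real ^ 'n \<Rightarrow> real ^ 'n \<Rightarrow> real ^ 'n \<Rightarrow> real ^ 'n \<Rightarrow> real ^ 'n"
  assumes bilinear_B: "bilinear B" and trilinear_P: "trilinear P" and trilinear_Q: "trilinear Q"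
    and quadrilinear_R: "quadrilinear R" and quadrilinear_S: "quadrilinear S"
    and quadrilinear_T: "quadrilinear T"
    and P_sym: "P x y z = P y x z" and Q_sym: "Q x y z = Q x z y"
    and R_sym: "R x y z w = R y x z w" "R x y z w = R x z y w"
    and S_sym: "S x y z w = S y x z w" "S x y z w = S x y w z"
    and T_sym: "T x y z w = T x z y w" "T x y z w = T x y w z"
begin

lemmas multilinear_simps = bilinear_simps[OF bilinear_B] trilinear_simps[OF trilinear_P]
  trilinear_simps[OF trilinear_Q] quadrilinear_simps[OF quadrilinear_R]
  quadrilinear_simps[OF quadrilinear_S] quadrilinear_simps[OF quadrilinear_T]

lemmas sym_simps = P_sym Q_sym R_sym S_sym T_sym

definition taylor :: "real ^ 'n \<Rightarrow> real ^ 'n \<Rightarrow> real ^ 'n" where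
  "taylor x y = x + y + B x y + (1/2) *\<^sub>R P x x y + (1/2) *\<^sub>R Q x y y
    + (1/6) *\<^sub>R R x x x y + (1/4) *\<^sub>R S x x y y + (1/6) *\<^sub>R T x y y y"

text \<open>The Taylor coefficients of \<open>F(u(t), v(t))\<close> for curves \<open>u\<close> and \<open>v\<close> through the origin.\<close>
definition jet_mult :: "(nat \<Rightarrow> real ^ 'n) \<Rightarrow> (nat \<Rightarrow> real ^ 'n) \<Rightarrow> nat \<Rightarrow> real ^ 'n" where
  "jet_mult u v k =
    (if k = 1 then u 1 + v 1
     else if k = 2 then u 2 + v 2 + B (u 1) (v 1)
     else if k = 3 then u 3 + v 3 + B (u 1) (v 2) + B (u 2) (v 1)
       + (1/2) *\<^sub>R P (u 1) (u 1) (v 1) + (1/2) *\<^sub>R Q (u 1) (v 1) (v 1)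
     else if k = 4 then u 4 + v 4 + B (u 1) (v 3) + B (u 2) (v 2) + B (u 3) (v 1)
       + P (u 1) (u 2) (v 1) + (1/2) *\<^sub>R P (u 1) (u 1) (v 2)
       + (1/2) *\<^sub>R Q (u 2) (v 1) (v 1) + Q (u 1) (v 1) (v 2)
       + (1/6) *\<^sub>R R (u 1) (u 1) (u 1) (v 1) + (1/4) *\<^sub>R S (u 1) (u 1) (v 1) (v 1)
       + (1/6) *\<^sub>R T (u 1) (v 1) (v 1) (v 1)
     else 0)"

definition line_jet :: "real ^ 'n \<Rightarrow> nat \<Rightarrow> real ^ 'n" where
  "line_jet x k = (if k = 1 then x else 0)"

lemma line_jet_simps [simp]:
  "line_jet x (Suc 0) = x" "line_jet x 2 = 0" "line_jet x 3 = 0" "line_jet x 4 = 0"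
  by (simp_all add: line_jet_def)

lemma jet_mult_simps:
  "jet_mult u v (Suc 0) = u 1 + v 1"
  "jet_mult u v 2 = u 2 + v 2 + B (u 1) (v 1)"
  "jet_mult u v 3 = u 3 + v 3 + B (u 1) (v 2) + B (u 2) (v 1)
       + (1/2) *\<^sub>R P (u 1) (u 1) (v 1) + (1/2) *\<^sub>R Q (u 1) (v 1) (v 1)"
  "jet_mult u v 4 = u 4 + v 4 + B (u 1) (v 3) + B (u 2) (v 2) + B (u 3) (v 1)
       + P (u 1) (u 2) (v 1) + (1/2) *\<^sub>R P (u 1) (u 1) (v 2)
       + (1/2) *\<^sub>R Q (u 2) (v 1) (v 1) + Q (u 1) (v 1) (v 2)
       + (1/6) *\<^sub>R R (u 1) (u 1) (u 1) (v 1) + (1/4) *\<^sub>R S (u 1) (u 1) (v 1) (v 1)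
       + (1/6) *\<^sub>R T (u 1) (v 1) (v 1) (v 1)"
  by (simp_all add: jet_mult_def)

text \<open>The parts \<open>A\<^sub>1\<^sub>1\<^sub>1, A\<^sub>1\<^sub>2\<^sub>1, A\<^sub>2\<^sub>1\<^sub>1, A\<^sub>1\<^sub>1\<^sub>2\<close> of \<open>A(x,y,z) = (xy)z - x(yz)\<close>, as mixed derivatives: an argument
slot of degree two is polarized into two arguments. In each definition the terms of \<open>(xy)z\<close> come with a
plus sign and those of \<open>x(yz)\<close> with a minus sign.\<close>
definition assoc111 where
  "assoc111 x y z = P x y z + B (B x y) z - Q x y z - B x (B y z)"

definition assoc121 where
  "assoc121 x y y' z = R x y y' z + P (B x y) y' z + P (B x y') y z + B (Q x y y') z
     - (T x y y' z + Q x y (B y' z) + Q x y' (B y z) + B x (P y y' z))"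

definition assoc211 where
  "assoc211 x x' y z = R x x' y z + P x (B x' y) z + P x' (B x y) z + B (P x x' y) z
     - (P x x' (B y z) + S x x' y z)"

definition assoc112 where
  "assoc112 x y z z' = S x y z z' + Q (B x y) z z'
     - (T x y z z' + Q x z (B y z') + Q x z' (B y z) + B x (Q y z z'))"

lemmas assoc_defs = assoc111_def assoc121_def assoc211_def assoc112_def

text \<open>Both sides are the part linear in each of \<open>x, y, z, w\<close> of \<open>((xy)z)w - x(y(zw))\<close>. The left-hand side
goes through \<open>(xy)(zw)\<close> and so is \<open>A(xy,z,w) + A(x,y,zw)\<close>; the right-hand side goes through
\<open>(x(yz))w\<close> and \<open>x((yz)w)\<close>, where the first and the last step change one factor of a product by \<open>A(x,y,z)\<close> or
\<open>A(y,z,w)\<close>.\<close>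
lemma pentagon:
  "assoc211 x y z w + assoc111 (B x y) z w + assoc112 x y z w + assoc111 x y (B z w)
   = B (assoc111 x y z) w + assoc121 x y z w + assoc111 x (B y z) w + B x (assoc111 y z w)"
  by (simp add: assoc_defs multilinear_simps sym_simps algebra_simps)

definition bracket :: "real ^ 'n \<Rightarrow> real ^ 'n \<Rightarrow> real ^ 'n" where
  "bracket x y = B x y - B y x"

text \<open>In the alternating sum the symmetric terms \<open>P\<close> and \<open>Q\<close> of \<open>A\<^sub>1\<^sub>1\<^sub>1\<close> cancel.\<close>
lemma Jacobi_sum_bracket_alternating:
  "Jacobi_sum bracket x y z =
     assoc111 x y z + assoc111 y z x + assoc111 z x y
     - assoc111 y x z - assoc111 x z y - assoc111 z y x"
  by (simp add: Jacobi_sum_def bracket_def assoc111_def multilinear_simps sym_simps algebra_simps)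

lemma assoc111_linear_simps:
  "assoc111 (x + x') y z = assoc111 x y z + assoc111 x' y z"
  "assoc111 x (y + y') z = assoc111 x y z + assoc111 x y' z"
  "assoc111 x y (z + z') = assoc111 x y z + assoc111 x y z'"
  "assoc111 (x - x') y z = assoc111 x y z - assoc111 x' y z"
  "assoc111 x (y - y') z = assoc111 x y z - assoc111 x y' z"
  "assoc111 x y (z - z') = assoc111 x y z - assoc111 x y z'"
  "assoc111 (- x) y z = - assoc111 x y z"
  "assoc111 x (- y) z = - assoc111 x y z"
  "assoc111 x y (- z) = - assoc111 x y z"
  by (simp_all add: assoc111_def multilinear_simps algebra_simps)


lemma assoc121_sym: "assoc121 x y' y z = assoc121 x y y' z"
  by (simp only: assoc121_def sym_simps) (simp add: algebra_simps)

lemma assoc121_outer_add: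
  "assoc121 (x + x') y y z = assoc121 x y y z + assoc121 x' y y z"
  "assoc121 x y y (z + z') = assoc121 x y y z + assoc121 x y y z'"
  by (simp_all add: assoc121_def multilinear_simps algebra_simps)

lemma assoc_polarize:
  "assoc121 x (y + y') (y + y') z = assoc121 x y y z + assoc121 x y' y' z + 2 *\<^sub>R assoc121 x y y' z"
  "assoc211 (y + y') (y + y') x z = assoc211 y y x z + assoc211 y' y' x z + 2 *\<^sub>R assoc211 y y' x z"
  "assoc112 x z (y + y') (y + y') = assoc112 x z y y + assoc112 x z y' y' + 2 *\<^sub>R assoc112 x z y y'"
  by (simp_all only: assoc_defs multilinear_simps sym_simps scaleR_2 vec_eq_iff) (simp_all add: algebra_simps)

end

section \<open>Moufang jets\<close>

text \<open>The part of order \<open>k\<close> of either side of \<open>(ag)(ha) = a(gh)a\<close> is a polynomial in \<open>a, g, h\<close>. It is obtained as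
the \<open>k\<close>-th Taylor coefficient in \<open>t\<close> along the three lines \<open>t \<mapsto> ta\<close>, \<open>t \<mapsto> tg\<close>, \<open>t \<mapsto> th\<close>.\<close>
locale Moufang_jet = loop_jet +
  assumes Moufang: "k < 5 \<Longrightarrow>
    jet_mult (jet_mult (line_jet a) (line_jet g)) (jet_mult (line_jet h) (line_jet a)) k =
    jet_mult (jet_mult (line_jet a) (jet_mult (line_jet g) (line_jet h))) (line_jet a) k"
begin

text \<open>The coefficients of order three and four are polynomials in \<open>a, g, h\<close>. Their parts of given degrees in
\<open>a\<close>, \<open>g\<close> and \<open>h\<close> are isolated below by combining instances: opposite signs of an argument select the
parity of its degree, and setting an argument to 0 gives the terms that do not contain it.\<close>
lemma Moufang_component:
  "jet_mult (jet_mult (line_jet a) (line_jet g)) (jet_mult (line_jet h) (line_jet a)) 3 $ i =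
    jet_mult (jet_mult (line_jet a) (jet_mult (line_jet g) (line_jet h))) (line_jet a) 3 $ i"
  "jet_mult (jet_mult (line_jet a) (line_jet g)) (jet_mult (line_jet h) (line_jet a)) 4 $ i =
    jet_mult (jet_mult (line_jet a) (jet_mult (line_jet g) (line_jet h))) (line_jet a) 4 $ i"
  using Moufang[of 3 a g h] Moufang[of 4 a g h] by auto

lemmas jet_expand = jet_mult_simps multilinear_simps sym_simps assoc_defs

text \<open>Degree one in each of \<open>a, g, h\<close>: the odd part in \<open>a\<close>, minus the terms without \<open>g\<close> or without \<open>h\<close>.\<close>
lemma assoc111_cyclic: "assoc111 x y z = assoc111 y z x"
proof -
  have "assoc111 x y z $ i = assoc111 y z x $ i" for i
    using Moufang_component(1)[of x y z i] Moufang_component(1)[of "-x" y z i]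
      Moufang_component(1)[of x 0 z i] Moufang_component(1)[of "-x" 0 z i]
      Moufang_component(1)[of x y 0 i] Moufang_component(1)[of "-x" y 0 i]
    by (simp only: jet_expand line_jet_simps One_nat_def add_0_left add_0_right, simp add: field_simps)
  then show ?thesis by (simp add: vec_eq_iff)
qed

text \<open>With \<open>g = 0\<close> the Moufang identity becomes the flexible law \<open>a(ha) = (ah)a\<close>. The odd part in \<open>a\<close> of the
coefficient of order three is removed, and the part of degrees 2, 1 in \<open>a, h\<close> remains.\<close>
lemma assoc111_flexible: "assoc111 x y x = 0"
proof -
  have "assoc111 x y x $ i = 0" for i
    using Moufang_component(1)[of x 0 y i] Moufang_component(1)[of "-x" 0 y i]
    by (simp only: jet_expand line_jet_simps One_nat_def add_0_left add_0_right, simp add: field_simps)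
  then show ?thesis by (simp add: vec_eq_iff)
qed

text \<open>The part of degrees 2, 2 in \<open>a, h\<close> of the flexible law.\<close>
lemma assoc121_flexible_diag: "assoc121 x y y x = 0"
proof -
  have "assoc121 x y y x $ i = 0" for i
    using Moufang_component(2)[of x 0 y i] Moufang_component(2)[of "-x" 0 y i]
    by (simp only: jet_expand line_jet_simps One_nat_def add_0_left add_0_right, simp add: field_simps)
  then show ?thesis by (simp add: vec_eq_iff)
qed

text \<open>Degrees 1, 2, 1 in \<open>a, g, h\<close>: odd in \<open>a\<close> and even in \<open>g\<close>, minus the terms without \<open>g\<close>.\<close>
lemma assoc121_211_diag: "assoc121 x y y z = assoc211 y y z x"
proof -
  have "assoc121 x y y z $ i = assoc211 y y z x $ i" for i
    using Moufang_component(2)[of x y z i] Moufang_component(2)[of "-x" y z i]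
      Moufang_component(2)[of x "-y" z i] Moufang_component(2)[of "-x" "-y" z i]
      Moufang_component(2)[of x 0 z i] Moufang_component(2)[of "-x" 0 z i]
    by (simp only: jet_expand line_jet_simps One_nat_def add_0_left add_0_right, simp add: field_simps)
  then show ?thesis by (simp add: vec_eq_iff)
qed

text \<open>Degrees 1, 1, 2 in \<open>a, g, h\<close>: odd in \<open>a\<close> and even in \<open>h\<close>, minus the terms without \<open>h\<close>.\<close>
lemma assoc112_121_diag: "assoc112 x y z z = assoc121 y z z x"
proof -
  have "assoc112 x y z z $ i = assoc121 y z z x $ i" for i
    using Moufang_component(2)[of x y z i] Moufang_component(2)[of "-x" y z i]
      Moufang_component(2)[of x y "-z" i] Moufang_component(2)[of "-x" y "-z" i]
      Moufang_component(2)[of x y 0 i] Moufang_component(2)[of "-x" y 0 i]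
    by (simp only: jet_expand line_jet_simps One_nat_def add_0_left add_0_right, simp add: field_simps)
  then show ?thesis by (simp add: vec_eq_iff)
qed

lemma assoc111_swap: "assoc111 x z y = - assoc111 x y z" "assoc111 y x z = - assoc111 x y z"
proof -
  have skew: "assoc111 z y x = - assoc111 x y z" for x y z
  proof -
    have "assoc111 (x + z) y (x + z) = 0" by (rule assoc111_flexible)
    then show ?thesis
      using assoc111_flexible[of x y] assoc111_flexible[of z y]
      by (simp add: assoc111_linear_simps add_eq_0_iff)
  qed
  show "assoc111 x z y = - assoc111 x y z"
    using skew[of y z x] assoc111_cyclic[of x y z] by simp
  show "assoc111 y x z = - assoc111 x y z"
    using skew[of z x y] assoc111_cyclic[of x y z] assoc111_cyclic[of z x y]
    by simp
qed

text \<open>The six signed terms of the alternating sum are equal, because \<open>A\<^sub>1\<^sub>1\<^sub>1\<close> is alternating.\<close>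
lemma Jacobi_sum_bracket: "Jacobi_sum bracket x y z = 6 *\<^sub>R assoc111 x y z"
proof -
  have "assoc111 y z x = assoc111 x y z" "assoc111 z x y = assoc111 x y z"
    "assoc111 y x z = - assoc111 x y z" "assoc111 x z y = - assoc111 x y z" "assoc111 z y x = - assoc111 x y z"
    using assoc111_cyclic[of x y z] assoc111_cyclic[of z x y]  assoc111_swap(2)[of x y z] assoc111_swap(1)[of x y z] assoc111_swap(2)[of y z x]
    by (simp_all)
  then show ?thesis unfolding Jacobi_sum_bracket_alternating by (simp add: vec_eq_iff)
qed

lemma assoc211_eq_121: "assoc211 y y' z x = assoc121 x y y' z"
  using assoc121_211_diag[of x "y + y'" z] assoc121_211_diag[of x y z] assoc121_211_diag[of x y' z]
  by (simp add: assoc_polarize)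

lemma assoc112_eq_121: "assoc112 x y z z' = assoc121 y z z' x"
  using assoc112_121_diag[of x y "z + z'"] assoc112_121_diag[of x y z] assoc112_121_diag[of x y z']
  by (simp add: assoc_polarize)

lemma assoc121_skew: "assoc121 z y y' x = - assoc121 x y y' z"
proof -
  have d: "assoc121 z y y x = - assoc121 x y y z" for x y z
    using assoc121_flexible_diag[of "x + z" y] assoc121_flexible_diag[of x y] assoc121_flexible_diag[of z y]
    by (simp add: assoc121_outer_add add_eq_0_iff2)
  have "2 *\<^sub>R assoc121 z y y' x = 2 *\<^sub>R (- assoc121 x y y' z)"
    using d[of z "y + y'" x] d[of z y x] d[of z y' x] by (simp add: assoc_polarize eq_neg_iff_add_eq_0 add.commute)
  then show ?thesis unfolding scaleR_cancel_left by simp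
qed

text \<open>For each pair among \<open>x, y, z, w\<close> there is, up to sign, one value of \<open>A\<^sub>1\<^sub>2\<^sub>1\<close> with this pair in the
middle, hence only six in all, while permuting the variables gives 24 equations for them.\<close>
lemma Moufang_pentagon:
  "assoc121 w x y z + assoc121 y z w x - assoc121 x y z w
   = B (assoc111 x y z) w + B x (assoc111 y z w)
     + assoc111 x (B y z) w - assoc111 (B x y) z w - assoc111 x y (B z w)"
  using pentagon[of x y z w] by (simp add: assoc211_eq_121 assoc112_eq_121 algebra_simps)

text \<open>The six values of \<open>A\<^sub>1\<^sub>2\<^sub>1\<close> cancel in a combination of six permuted pentagons with coefficients
\<open>\<plusminus>1\<close>.\<close>
lemma assoc111_Malcev_identity:
  "bracket (assoc111 x y z) w - bracket (assoc111 x y w) z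
   = 2 *\<^sub>R assoc111 (bracket x y) z w + assoc111 (bracket z w) x y"
proof -
  have B_first: "assoc111 u (B v v') u' = - assoc111 (B v v') u u'"
      "assoc111 u u' (B v v') = assoc111 (B v v') u u'" for u u' v v'
    using assoc111_swap(2)[of u "B v v'" u'] assoc111_cyclic[of "B v v'" u u'] by simp_all
  \<comment> \<open>The rules below sort the arguments into the order \<open>x, y, z, w\<close>, so that equal values of
    \<open>A\<^sub>1\<^sub>1\<^sub>1\<close> and \<open>A\<^sub>1\<^sub>2\<^sub>1\<close> become syntactically equal.\<close>
  have order: "assoc111 u y x = - assoc111 u x y" "assoc111 u z x = - assoc111 u x z"
      "assoc111 u w x = - assoc111 u x w" "assoc111 u z y = - assoc111 u y z"
      "assoc111 u w y = - assoc111 u y w" "assoc111 u w z = - assoc111 u z w"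
      "assoc111 y x u = - assoc111 x y u" "assoc111 z x u = - assoc111 x z u"
      "assoc111 w x u = - assoc111 x w u" "assoc111 z y u = - assoc111 y z u"
      "assoc111 w y u = - assoc111 y w u" "assoc111 w z u = - assoc111 z w u" for u
    by (rule assoc111_swap)+
  have order121: "assoc121 u y x v = assoc121 u x y v" "assoc121 u z x v = assoc121 u x z v"
      "assoc121 u w x v = assoc121 u x w v" "assoc121 u z y v = assoc121 u y z v"
      "assoc121 u w y v = assoc121 u y w v" "assoc121 u w z v = assoc121 u z w v"
      "assoc121 y u v x = - assoc121 x u v y" "assoc121 z u v x = - assoc121 x u v z"
      "assoc121 w u v x = - assoc121 x u v w" "assoc121 z u v y = - assoc121 y u v z"
      "assoc121 w u v y = - assoc121 y u v w" "assoc121 w u v z = - assoc121 z u v w" for u v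
    by (rule assoc121_sym assoc121_skew)+
  have "(bracket (assoc111 x y z) w - bracket (assoc111 x y w) z) $ i
    = (2 *\<^sub>R assoc111 (bracket x y) z w + assoc111 (bracket z w) x y) $ i" for i
    using arg_cong[OF Moufang_pentagon[of y z w x], of "\<lambda>v. v $ i"]
      arg_cong[OF Moufang_pentagon[of x z y w], of "\<lambda>v. v $ i"]
      arg_cong[OF Moufang_pentagon[of y x w z], of "\<lambda>v. v $ i"]
      arg_cong[OF Moufang_pentagon[of z x y w], of "\<lambda>v. v $ i"]
      arg_cong[OF Moufang_pentagon[of w z y x], of "\<lambda>v. v $ i"]
      arg_cong[OF Moufang_pentagon[of x w z y], of "\<lambda>v. v $ i"]
    by (simp add: order order121 B_first bracket_def assoc111_linear_simps multilinear_simps)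
  then show ?thesis by (simp add: vec_eq_iff)
qed

lemma bracket_Malcev_identity:
  "bracket (Jacobi_sum bracket x y z) w - bracket (Jacobi_sum bracket x y w) z
   = 2 *\<^sub>R Jacobi_sum bracket (bracket x y) z w + Jacobi_sum bracket (bracket z w) x y"
  using arg_cong[OF assoc111_Malcev_identity[of x y z w], of "\<lambda>v. 6 *\<^sub>R v"]
  by (simp add: Jacobi_sum_bracket bracket_def multilinear_simps algebra_simps)

end

section \<open>Lie triple identities from the Jacobian\<close>

lemma yamaguti_bracket_eq:
  assumes "bilinear br" and "\<And>x y. br y x = - br x y"
  shows "yamaguti_bracket br x y z = 2 *\<^sub>R br (br x y) z - Jacobi_sum br x y z"
  using assms(2)[of "br y z" x] assms(2)[of "br x z" y] assms(2)[of x z]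
  by (simp add: yamaguti_bracket_def Jacobi_sum_def scaleR_2 bilinear_simps[OF assms(1)])

text \<open>Over the reals the third assumption is equivalent to the Mal'tsev identity
\<open>J(x,y,[x,z]) = [J(x,y,z),x]\<close>. In the form used here it is the derivation property of the ternary
Yamaguti brackets, by \<open>yamaguti_bracket_eq\<close>.\<close>
locale Malcev_bracket =
  fixes br :: "'a::real_vector \<Rightarrow> 'a \<Rightarrow> 'a"
  assumes bilinear: "bilinear br" and skew: "br y x = - br x y"
    and Malcev_identity: "br (Jacobi_sum br x y z) w - br (Jacobi_sum br x y w) z
      = 2 *\<^sub>R Jacobi_sum br (br x y) z w + Jacobi_sum br (br z w) x y"
begin

lemmas br_simps = bilinear_simps[OF bilinear]

lemma yamaguti_bracket_derivation: "yamaguti_bracket br x y (br z u) = br (yamaguti_bracket br x y z) u + br z (yamaguti_bracket br x y u)"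
proof -
  have "br (br z u) (br x y) = - br (br x y) (br z u)" by (rule skew)
  moreover have "br (br u (br x y)) z = br z (br (br x y) u)"
    using skew[of u "br x y"] skew[of z "br (br x y) u"] by (simp add: br_simps)
  ultimately have "2 *\<^sub>R br (br x y) (br z u)
      = 2 *\<^sub>R (br (br (br x y) z) u + br z (br (br x y) u) - Jacobi_sum br (br x y) z u)"
    by (simp add: Jacobi_sum_def)
  moreover have "Jacobi_sum br x y (br z u) = Jacobi_sum br (br z u) x y"
    by (simp add: Jacobi_sum_def)
  ultimately show ?thesis using Malcev_identity[of x y z u] skew[of z "Jacobi_sum br x y u"]
    by (simp add: yamaguti_bracket_eq[OF bilinear skew] br_simps algebra_simps)
qed

text \<open>By \<open>yamaguti_bracket_eq\<close> the claim is that the cyclic sum of \<open>J([x,y],z,u)\<close> over \<open>x, y, z\<close> equals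
\<open>2 [J(x,y,z),u]\<close>. Exchanging the pairs \<open>(a,b)\<close> and \<open>(c,d)\<close> in the Mal'tsev identity gives two linear
equations for \<open>J([a,b],c,d)\<close> and \<open>J([c,d],a,b)\<close>. Solving them expresses \<open>J([a,b],c,d)\<close> by terms of the form
\<open>[J(\<dots>),-]\<close>, and in the cyclic sum all of these but \<open>[J(x,y,z),u]\<close> cancel.\<close>
lemma yamaguti_bracket_cyclic: "yamaguti_bracket br (br x y) z u + yamaguti_bracket br (br y z) x u
    + yamaguti_bracket br (br z x) y u = 0"
proof -
  have swap: "Jacobi_sum br b a c = - Jacobi_sum br a b c" "Jacobi_sum br a c b = - Jacobi_sum br a b c" for a b c
    using skew[of a b] skew[of b c] skew[of c a] by (simp_all add: Jacobi_sum_def br_simps)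
  have order: "Jacobi_sum br v y x = - Jacobi_sum br v x y" "Jacobi_sum br v z x = - Jacobi_sum br v x z"
      "Jacobi_sum br v u x = - Jacobi_sum br v x u" "Jacobi_sum br v z y = - Jacobi_sum br v y z"
      "Jacobi_sum br v u y = - Jacobi_sum br v y u" "Jacobi_sum br v u z = - Jacobi_sum br v z u"
      "Jacobi_sum br y x v = - Jacobi_sum br x y v" "Jacobi_sum br z x v = - Jacobi_sum br x z v"
      "Jacobi_sum br u x v = - Jacobi_sum br x u v" "Jacobi_sum br z y v = - Jacobi_sum br y z v"
      "Jacobi_sum br u y v = - Jacobi_sum br y u v" "Jacobi_sum br u z v = - Jacobi_sum br z u v" for v
    by (rule swap)+
  have 3: "3 *\<^sub>R Jacobi_sum br (br a b) c d = 2 *\<^sub>R br (Jacobi_sum br a b c) d - 2 *\<^sub>R br (Jacobi_sum br a b d) c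
     - br (Jacobi_sum br c d a) b + br (Jacobi_sum br c d b) a" for a b c d
  proof -
    have "3 *\<^sub>R v = 4 *\<^sub>R v - v" for v :: 'a
      using scaleR_left_diff_distrib[of 4 1 v] by simp
    then show ?thesis
      using arg_cong[OF Malcev_identity[of a b c d], of "\<lambda>v. 2 *\<^sub>R v"] Malcev_identity[of c d a b]
      by (simp add: algebra_simps)
  qed
  have "3 *\<^sub>R (Jacobi_sum br (br x y) z u + Jacobi_sum br (br y z) x u + Jacobi_sum br (br z x) y u)
      = 3 *\<^sub>R (2 *\<^sub>R br (Jacobi_sum br x y z) u)"
  proof -
    have "3 *\<^sub>R v = v + v + v" "4 *\<^sub>R v = v + v + v + v" for v :: 'a
      using scaleR_add_left[of 2 1 v] scaleR_add_left[of 2 2 v] by (simp_all add: scaleR_2)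
    then show ?thesis
      unfolding scaleR_add_right 3 order br_simps by (simp add: scaleR_2)
  qed
  then have "Jacobi_sum br (br x y) z u + Jacobi_sum br (br y z) x u + Jacobi_sum br (br z x) y u
      = 2 *\<^sub>R br (Jacobi_sum br x y z) u"
    by (simp only: scaleR_cancel_left) simp
  moreover have "br (Jacobi_sum br x y z) u = br (br (br x y) z) u + br (br (br y z) x) u + br (br (br z x) y) u"
    by (simp add: Jacobi_sum_def br_simps)
  ultimately show ?thesis
    by (simp add: yamaguti_bracket_eq[OF bilinear skew] algebra_simps flip: scaleR_add_right)
qed

lemma linear_yamaguti_bracket:
  "linear (\<lambda>x. yamaguti_bracket br x y z)" "linear (\<lambda>y. yamaguti_bracket br x y z)"
  "linear (\<lambda>z. yamaguti_bracket br x y z)"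
  by (auto intro!: linearI simp: yamaguti_bracket_def br_simps algebra_simps)

lemma is_general_Lie_triple_system: "general_Lie_triple_system UNIV br (yamaguti_bracket br)"
proof
  show "linear_map_on UNIV (\<lambda>z. br z y) \<and> linear_map_on UNIV (br x)" for x y
    by (simp add: linear_map_on_def br_simps)
  show "linear_map_on UNIV (\<lambda>w. yamaguti_bracket br w y z) \<and>
      linear_map_on UNIV (\<lambda>w. yamaguti_bracket br x w z) \<and> linear_map_on UNIV (yamaguti_bracket br x y)"
    for x y z
    using linear_map_simps(1,3)[OF linear_yamaguti_bracket(1)] linear_map_simps(1,3)[OF linear_yamaguti_bracket(2)]
      linear_map_simps(1,3)[OF linear_yamaguti_bracket(3)]
    by (simp add: linear_map_on_def)
  show "br x y = - br y x" for x y by (rule skew)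
  show "yamaguti_bracket br x y z = - yamaguti_bracket br y x z" for x y z
    using skew[of x y] by (simp add: yamaguti_bracket_def br_simps)
  show "yamaguti_bracket br x y z + yamaguti_bracket br y z x + yamaguti_bracket br z x y
      + br (br x y) z + br (br y z) x + br (br z x) y = 0" for x y z
    using skew[of x "br y z"] skew[of y "br z x"] skew[of z "br x y"] skew[of x z] skew[of y x] skew[of z y]
    by (simp add: yamaguti_bracket_def br_simps)
  show "yamaguti_bracket br x y (yamaguti_bracket br z w v) =
      yamaguti_bracket br (yamaguti_bracket br x y z) w v + yamaguti_bracket br z (yamaguti_bracket br x y w) v
      + yamaguti_bracket br z w (yamaguti_bracket br x y v)" for x y z w v
  proof -
    \<comment> \<open>A linear derivation of the bracket is a derivation of everything built from it.\<close>
    define D where "D = yamaguti_bracket br x y"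
    have "D (br a b) = br (D a) b + br a (D b)" for a b
      unfolding D_def by (rule yamaguti_bracket_derivation)
    moreover have "linear D"
      unfolding D_def using linear_yamaguti_bracket(3) .
    ultimately have "D (yamaguti_bracket br z w v) =
      yamaguti_bracket br (D z) w v + yamaguti_bracket br z (D w) v + yamaguti_bracket br z w (D v)"
      by (simp add: yamaguti_bracket_def linear_map_simps br_simps)
    then show ?thesis by (simp add: D_def)
  qed
qed (auto simp: yamaguti_bracket_derivation yamaguti_bracket_cyclic)

end

section \<open>Expansion of an analytic multiplication\<close>

context loop_jet begin

lemma has_jet_taylor:
  assumes u: "has_jet f u" "u 0 = 0" and v: "has_jet g v" "v 0 = 0"
  shows "has_jet (\<lambda>t. taylor (f t) (g t)) (jet_mult u v)"
proof -
  have quad: "has_jet (\<lambda>t. f (p t) (q t) (r t) (s t))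
    (\<lambda>k. \<Sum>i\<le>k. \<Sum>j\<le>k - i. \<Sum>l\<le>k - i - j. f (u i) (v j) (w l) (x (k - i - j - l)))"
   if "quadrilinear f" "has_jet p u" "has_jet q v" "has_jet r w" "has_jet s x"
   for f :: "real^'n \<Rightarrow> real^'n \<Rightarrow> real^'n \<Rightarrow> real^'n \<Rightarrow> real^'n" and p q r s u v w x
    using that by (intro has_jet_quadrilinear) (auto simp: quadrilinear_def trilinear_def)
  have tri: "has_jet (\<lambda>t. f (p t) (q t) (r t))
    (\<lambda>k. \<Sum>i\<le>k. \<Sum>j\<le>k - i. f (u i) (v j) (w (k - i - j)))"
   if "trilinear f" "has_jet p u" "has_jet q v" "has_jet r w"
   for f :: "real^'n \<Rightarrow> real^'n \<Rightarrow> real^'n \<Rightarrow> real^'n" and p q r u v w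
    using that by (intro has_jet_trilinear) (auto simp: trilinear_def)
  note jets = has_jet_add[OF has_jet_add[OF has_jet_add[OF has_jet_add[OF has_jet_add[OF has_jet_add[OF has_jet_add[OF
    u(1) v(1)]
    has_jet_bilinear[OF bilinear_B u(1) v(1)]]
    has_jet_scaleR_const[where c = "1/2", OF tri[OF trilinear_P u(1) u(1) v(1)]]]
    has_jet_scaleR_const[where c = "1/2", OF tri[OF trilinear_Q u(1) v(1) v(1)]]]
    has_jet_scaleR_const[where c = "1/6", OF quad[OF quadrilinear_R u(1) u(1) u(1) v(1)]]]
    has_jet_scaleR_const[where c = "1/4", OF quad[OF quadrilinear_S u(1) u(1) v(1) v(1)]]]
    has_jet_scaleR_const[where c = "1/6", OF quad[OF quadrilinear_T u(1) v(1) v(1) v(1)]]]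
  show ?thesis
  proof (rule has_jet_cong[OF jets], goal_cases)
    case 1
    show ?case by (simp add: taylor_def)
  next
    case (2 k)
    then have "k = 0 \<or> k = 1 \<or> k = 2 \<or> k = 3 \<or> k = 4" by auto
    then show ?case
      by (elim disjE, simp_all add: jet_mult_def u(2) v(2) multilinear_simps eval_nat_numeral sym_simps)
        (simp add: vec_eq_iff field_simps)
  qed
qed

text \<open>This is the form of the expansion in which the structure coefficients are defined.\<close>
lemma second_order_remainder:
  assumes big: "(\<lambda>z. norm (F (fst z) (snd z) - taylor (fst z) (snd z))) \<in> O[nhds (0, 0)](\<lambda>z. norm z ^ 5)"
  shows "(\<lambda>z. norm (F (fst z) (snd z) - (fst z + snd z + B (fst z) (snd z)))) \<in> O[nhds (0, 0)](\<lambda>z. norm z ^ 3)"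
proof -
  let ?x = "fst :: (real ^ 'n) \<times> (real ^ 'n) \<Rightarrow> real ^ 'n" and ?y = "snd :: (real ^ 'n) \<times> (real ^ 'n) \<Rightarrow> real ^ 'n"
  have le: "norm (?x z) \<le> norm z" "norm (?y z) \<le> norm z" for z
    using norm_fst_le[of "?x z" "?y z"] norm_snd_le[of "?y z" "?x z"] by simp_all
  have up: "(\<lambda>z. norm z ^ n) \<in> O[nhds ((0, 0) :: (real ^ 'n) \<times> (real ^ 'n))](\<lambda>z. norm z ^ 3)" if "3 \<le> n" for n
    using norm_power_bigo[OF that, where 'a = "(real ^ 'n) \<times> (real ^ 'n)"] by (simp add: zero_prod_def)
  have tri: "(\<lambda>z. norm (r *\<^sub>R f (a z) (b z) (c z))) \<in> O[nhds (0, 0)](\<lambda>z. norm z ^ 3)"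
    if f: "trilinear f" and le: "\<And>z. norm (a z) \<le> norm z" "\<And>z. norm (b z) \<le> norm z" "\<And>z. norm (c z) \<le> norm z"
    for f :: "real ^ 'n \<Rightarrow> real ^ 'n \<Rightarrow> real ^ 'n \<Rightarrow> real ^ 'n" and r :: real
      and a b c :: "(real ^ 'n) \<times> (real ^ 'n) \<Rightarrow> real ^ 'n"
  proof -
    obtain K where K: "\<And>x y z. norm (f x y z) \<le> K * norm x * norm y * norm z"
      using trilinear_bound[OF f] by blast
    have "norm (r *\<^sub>R f (a z) (b z) (c z)) \<le> \<bar>r\<bar> * \<bar>K\<bar> * norm z ^ 3" for z
    proof -
      have "norm (f (a z) (b z) (c z)) \<le> K * norm (a z) * norm (b z) * norm (c z)" by (rule K)
      also have "\<dots> \<le> \<bar>K\<bar> * norm z * norm z * norm z"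
        by (intro mult_mono le) auto
      finally have "norm (f (a z) (b z) (c z)) \<le> \<bar>K\<bar> * norm z * norm z * norm z" .
      from mult_left_mono[OF this abs_ge_zero[of r]] show ?thesis by (simp add: power3_eq_cube mult_ac)
    qed
    then show ?thesis by (intro bigoI[where c = "\<bar>r\<bar> * \<bar>K\<bar>"] always_eventually) auto
  qed
  have quad: "(\<lambda>z. norm (r *\<^sub>R f (a z) (b z) (c z) (d z))) \<in> O[nhds (0, 0)](\<lambda>z. norm z ^ 3)"
    if f: "quadrilinear f" and le: "\<And>z. norm (a z) \<le> norm z" "\<And>z. norm (b z) \<le> norm z" "\<And>z. norm (c z) \<le> norm z"
      "\<And>z. norm (d z) \<le> norm z"
    for f :: "real ^ 'n \<Rightarrow> real ^ 'n \<Rightarrow> real ^ 'n \<Rightarrow> real ^ 'n \<Rightarrow> real ^ 'n" and r :: real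
      and a b c d :: "(real ^ 'n) \<times> (real ^ 'n) \<Rightarrow> real ^ 'n"
  proof -
    obtain K where K: "\<And>x y z w. norm (f x y z w) \<le> K * norm x * norm y * norm z * norm w"
      using quadrilinear_bound[OF f] by blast
    have "norm (r *\<^sub>R f (a z) (b z) (c z) (d z)) \<le> \<bar>r\<bar> * \<bar>K\<bar> * norm z ^ 4" for z
    proof -
      have "norm (f (a z) (b z) (c z) (d z)) \<le> K * norm (a z) * norm (b z) * norm (c z) * norm (d z)" by (rule K)
      also have "\<dots> \<le> \<bar>K\<bar> * norm z * norm z * norm z * norm z"
        by (intro mult_mono le) auto
      finally have "norm (f (a z) (b z) (c z) (d z)) \<le> \<bar>K\<bar> * norm z * norm z * norm z * norm z" .
      from mult_left_mono[OF this abs_ge_zero[of r]] show ?thesis by (simp add: power4_eq_xxxx mult_ac)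
    qed
    then have "(\<lambda>z. norm (r *\<^sub>R f (a z) (b z) (c z) (d z))) \<in> O[nhds (0, 0)](\<lambda>z. norm z ^ 4)"
      by (intro bigoI[where c = "\<bar>r\<bar> * \<bar>K\<bar>"] always_eventually) auto
    then show ?thesis by (rule landau_o.big_trans) (rule up, simp)
  qed
  have "(\<lambda>z. norm (F (?x z) (?y z) - taylor (?x z) (?y z))) \<in> O[nhds (0, 0)](\<lambda>z. norm z ^ 3)"
    using big by (rule landau_o.big_trans) (rule up, simp)
  then have "(\<lambda>z. norm ((F (?x z) (?y z) - taylor (?x z) (?y z))
      + (1/2) *\<^sub>R P (?x z) (?x z) (?y z) + (1/2) *\<^sub>R Q (?x z) (?y z) (?y z)
      + (1/6) *\<^sub>R R (?x z) (?x z) (?x z) (?y z) + (1/4) *\<^sub>R S (?x z) (?x z) (?y z) (?y z)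
      + (1/6) *\<^sub>R T (?x z) (?y z) (?y z) (?y z))) \<in> O[nhds (0, 0)](\<lambda>z. norm z ^ 3)"
    by (intro norm_bigo_add tri[OF trilinear_P] tri[OF trilinear_Q] quad[OF quadrilinear_R]
        quad[OF quadrilinear_S] quad[OF quadrilinear_T] le)
  then show ?thesis by (simp add: taylor_def algebra_simps)
qed

lemma B_components: "B x y $ i = (\<Sum>j\<in>UNIV. \<Sum>k\<in>UNIV. B (axis j 1) (axis k 1) $ i * x $ j * y $ k)"
proof -
  have e: "z = (\<Sum>j\<in>UNIV. z $ j *\<^sub>R axis j 1)" for z :: "real ^ 'n"
    by (simp add: vec_eq_iff axis_def if_distrib[of "\<lambda>r. _ * r"] cong: if_cong)
  have "B x y = B (\<Sum>j\<in>UNIV. x $ j *\<^sub>R axis j 1) (\<Sum>k\<in>UNIV. y $ k *\<^sub>R axis k 1)"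
    by (simp flip: e)
  also have "\<dots> = (\<Sum>j\<in>UNIV. \<Sum>k\<in>UNIV. (x $ j * y $ k) *\<^sub>R B (axis j 1) (axis k 1))"
    using bilinear_B by (simp add: bilinear_sum sum.cartesian_product case_prod_unfold bilinear_lmul bilinear_rmul mult_ac)
  finally show ?thesis by (simp add: mult_ac)
qed

end

text \<open>The unit laws along the two coordinate axes kill the pure parts of the expansion of \<open>F\<close> on the
product space. Splitting \<open>(x,y) = (x,0) + (0,y)\<close> in the remaining symmetric maps gives the mixed
derivatives; the factors 2, 6 and 24 are those between a symmetric form and the derivative.\<close>
lemma loop_expansion:
  fixes F :: "real ^ 'n \<Rightarrow> real ^ 'n \<Rightarrow> real ^ 'n"
  assumes analytic: "real_analytic_at (\<lambda>(x, y). F x y) (0, 0)"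
    and unit: "\<forall>\<^sub>F x in nhds 0. F x 0 = x \<and> F 0 x = x"
  obtains B P Q R S T where "loop_jet B P Q R S T"
    "(\<lambda>z. norm (F (fst z) (snd z) - loop_jet.taylor B P Q R S T (fst z) (snd z))) \<in> O[nhds (0, 0)](\<lambda>z. norm z ^ 5)"
proof -
  define G where "G = (\<lambda>(x, y). F x y)"
  have "real_analytic_at G (0, 0)" using analytic unfolding G_def .
  then obtain M\<^sub>0 M\<^sub>1 M\<^sub>2 M\<^sub>3 M\<^sub>4 where lin: "linear M\<^sub>1" "bilinear M\<^sub>2" "trilinear M\<^sub>3" "quadrilinear M\<^sub>4"
    and sym: "\<And>x y. M\<^sub>2 x y = M\<^sub>2 y x"
    "\<And>x y z. M\<^sub>3 x y z = M\<^sub>3 y x z" "\<And>x y z. M\<^sub>3 x y z = M\<^sub>3 x z y"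
    "\<And>x y z w. M\<^sub>4 x y z w = M\<^sub>4 y x z w" "\<And>x y z w. M\<^sub>4 x y z w = M\<^sub>4 x z y w"
    "\<And>x y z w. M\<^sub>4 x y z w = M\<^sub>4 x y w z"
    and big: "(\<lambda>z. norm (G ((0, 0) + z) - (M\<^sub>0 + M\<^sub>1 z + M\<^sub>2 z z + M\<^sub>3 z z z + M\<^sub>4 z z z z))) \<in> O[nhds 0](\<lambda>z. norm z ^ 5)"
    by (elim real_analytic_expansion) (rule that)
  define H where "H z = M\<^sub>0 + M\<^sub>1 z + M\<^sub>2 z z + M\<^sub>3 z z z + M\<^sub>4 z z z z" for z
  have big: "(\<lambda>z. norm (G z - H z)) \<in> O[nhds 0](\<lambda>z. norm z ^ 5)"
    using big by (simp add: H_def flip: zero_prod_def)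
  note lins = linear_map_simps[OF lin(1)] bilinear_simps[OF lin(2)] trilinear_simps[OF lin(3)]
    quadrilinear_simps[OF lin(4)]
  define v where "v z k = [M\<^sub>0, M\<^sub>1 z, M\<^sub>2 z z, M\<^sub>3 z z z, M\<^sub>4 z z z z] ! k" for z k
  have jet: "has_jet (\<lambda>t. G (t *\<^sub>R z)) (v z)" for z
  proof (rule has_jet_of_expansion[OF big has_jet_line])
    have "H (t *\<^sub>R z) = (\<Sum>k<5. t ^ k *\<^sub>R v z k)" for t
      by (simp add: H_def v_def lins eval_nat_numeral mult_ac)
    then show "has_jet (\<lambda>t. H (t *\<^sub>R z)) (v z)" by (simp add: has_jet_poly)
  qed simp
  have axis: "v z k = (if k = 1 then x else 0)"
    if "z = (x, 0) \<or> z = (0, x)" "k < 5" for z x k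
  proof -
    have "((\<lambda>t. t *\<^sub>R x) \<longlongrightarrow> 0) (at 0)" by (auto intro!: tendsto_eq_intros)
    then have "\<forall>\<^sub>F t in at 0. F (t *\<^sub>R x) 0 = t *\<^sub>R x \<and> F 0 (t *\<^sub>R x) = t *\<^sub>R x"
      using unit by (auto simp: filterlim_iff)
    then have "\<forall>\<^sub>F t in at 0. G (t *\<^sub>R z) = t *\<^sub>R x"
      using that(1) by (auto simp: G_def elim!: eventually_mono)
    then have "has_jet (\<lambda>t. t *\<^sub>R x) (v z)" by (rule has_jet_cong[OF jet]) simp
    from has_jet_unique[OF this has_jet_line that(2)] show ?thesis .
  qed
  have M\<^sub>0: "M\<^sub>0 = 0" using axis[of "(0, 0)" 0 0] by (simp add: v_def)
  have M\<^sub>1: "M\<^sub>1 (x, 0) = x" "M\<^sub>1 (0, x) = x" for x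
    using axis[of "(x, 0)" x 1] axis[of "(0, x)" x 1] by (simp_all add: v_def)
  have M\<^sub>2: "M\<^sub>2 (x, 0) (x, 0) = 0" "M\<^sub>2 (0, x) (0, x) = 0" for x
    using axis[of "(x, 0)" x 2] axis[of "(0, x)" x 2] by (simp_all add: v_def)
  have M\<^sub>3: "M\<^sub>3 (x, 0) (x, 0) (x, 0) = 0" "M\<^sub>3 (0, x) (0, x) (0, x) = 0" for x
    using axis[of "(x, 0)" x 3] axis[of "(0, x)" x 3] by (simp_all add: v_def)
  have M\<^sub>4: "M\<^sub>4 (x, 0) (x, 0) (x, 0) (x, 0) = 0" "M\<^sub>4 (0, x) (0, x) (0, x) (0, x) = 0" for x
    using axis[of "(x, 0)" x 4] axis[of "(0, x)" x 4] by (simp_all add: v_def)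
  define B where "B x y = 2 *\<^sub>R M\<^sub>2 (x, 0) (0, y)" for x y
  define P where "P x x' y = 6 *\<^sub>R M\<^sub>3 (x, 0) (x', 0) (0, y)" for x x' y
  define Q where "Q x y y' = 6 *\<^sub>R M\<^sub>3 (x, 0) (0, y) (0, y')" for x y y'
  define R where "R x x' x'' y = 24 *\<^sub>R M\<^sub>4 (x, 0) (x', 0) (x'', 0) (0, y)" for x x' x'' y
  define S where "S x x' y y' = 24 *\<^sub>R M\<^sub>4 (x, 0) (x', 0) (0, y) (0, y')" for x x' y y'
  define T where "T x y y' y'' = 24 *\<^sub>R M\<^sub>4 (x, 0) (0, y) (0, y') (0, y'')" for x y y' y''
  interpret loop_jet B P Q R S T
  proof
    show "bilinear B"
      using bilinear_comp[OF lin(2) linear_inl linear_inr]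
      by (simp add: bilinear_def B_def linear_compose_scale_right)
    show "trilinear P" "trilinear Q"
      unfolding P_def Q_def by (intro trilinear_comp lin linear_inl linear_inr)+
    show "quadrilinear R" "quadrilinear S" "quadrilinear T"
      unfolding R_def S_def T_def by (intro quadrilinear_comp lin linear_inl linear_inr)+
  qed (unfold P_def Q_def R_def S_def T_def, (subst sym, simp)+)
  have "H (x, y) = taylor x y" for x y
  proof -
    have "(x, y) = (x, 0) + (0, y)" by simp
    then have "H (x, y) = H ((x, 0) + (0, y))" by simp
    also have "\<dots> = taylor x y"
      by (simp only: H_def lins M\<^sub>0 M\<^sub>1 M\<^sub>2 M\<^sub>3 M\<^sub>4 sym taylor_def B_def P_def Q_def R_def S_def T_def)
        (simp add: vec_eq_iff)
    finally show ?thesis .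
  qed
  then have "norm (F (fst z) (snd z) - taylor (fst z) (snd z)) = norm (G z - H z)" for z
    by (cases z) (simp add: G_def)
  with big have "(\<lambda>z. norm (F (fst z) (snd z) - taylor (fst z) (snd z))) \<in> O[nhds (0, 0)](\<lambda>z. norm z ^ 5)"
    by (simp add: zero_prod_def)
  then show thesis using that loop_jet_axioms by blast
qed

lemma Moufang_expansion:
  fixes F :: "real ^ 'n \<Rightarrow> real ^ 'n \<Rightarrow> real ^ 'n"
  assumes "loop_jet B P Q R S T"
    and big: "(\<lambda>z. norm (F (fst z) (snd z) - loop_jet.taylor B P Q R S T (fst z) (snd z))) \<in> O[nhds (0, 0)](\<lambda>z. norm z ^ 5)"
    and Moufang: "\<And>a g h. \<forall>\<^sub>F t in at 0.
        F (F (t *\<^sub>R a) (t *\<^sub>R g)) (F (t *\<^sub>R h) (t *\<^sub>R a)) = F (F (t *\<^sub>R a) (F (t *\<^sub>R g) (t *\<^sub>R h))) (t *\<^sub>R a)"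
  shows "Moufang_jet B P Q R S T"
proof -
  interpret loop_jet B P Q R S T by fact
  have line: "has_jet (\<lambda>t. t *\<^sub>R z) (line_jet z)" for z
    using has_jet_line[of z] by (simp add: line_jet_def[abs_def])
  have 0: "line_jet z 0 = 0" "jet_mult u v 0 = 0" for z u v
    by (simp_all add: line_jet_def jet_mult_def)
  have mult: "has_jet (\<lambda>t. F (f t) (g t)) (jet_mult u v)"
    if "has_jet f u" "u 0 = 0" "has_jet g v" "v 0 = 0" for f g u v
  proof -
    have "has_jet (\<lambda>t. (f t, g t)) (\<lambda>k. (u k, v k))"
      using has_jet_add[OF bounded_linear.has_jet[OF _ that(1), of "\<lambda>x. (x, 0)"] bounded_linear.has_jet[OF _ that(3), of "\<lambda>y. (0, y)"]]
      by (simp add: linear_inl linear_inr linear_linear)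
    from has_jet_of_expansion[OF big[folded zero_prod_def] this] show ?thesis
      using has_jet_taylor[OF that] that by (simp add: zero_prod_def)
  qed
  show ?thesis
  proof
    fix k :: nat and a g h assume "k < 5"
    have "has_jet (\<lambda>t. F (F (t *\<^sub>R a) (t *\<^sub>R g)) (F (t *\<^sub>R h) (t *\<^sub>R a)))
        (jet_mult (jet_mult (line_jet a) (line_jet g)) (jet_mult (line_jet h) (line_jet a)))"
      by (intro mult line 0)
    then have "has_jet (\<lambda>t. F (F (t *\<^sub>R a) (F (t *\<^sub>R g) (t *\<^sub>R h))) (t *\<^sub>R a))
        (jet_mult (jet_mult (line_jet a) (line_jet g)) (jet_mult (line_jet h) (line_jet a)))"
      using Moufang by (rule has_jet_cong) simp
    moreover have "has_jet (\<lambda>t. F (F (t *\<^sub>R a) (F (t *\<^sub>R g) (t *\<^sub>R h))) (t *\<^sub>R a))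
        (jet_mult (jet_mult (line_jet a) (jet_mult (line_jet g) (line_jet h))) (line_jet a))"
      by (intro mult line 0)
    ultimately show "jet_mult (jet_mult (line_jet a) (line_jet g)) (jet_mult (line_jet h) (line_jet a)) k =
        jet_mult (jet_mult (line_jet a) (jet_mult (line_jet g) (line_jet h))) (line_jet a) k"
      using \<open>k < 5\<close> by (rule has_jet_unique)
  qed
qed

text \<open>On the curve \<open>t \<mapsto> (t e\<^sub>j, t e\<^sub>k)\<close> the form is \<open>t\<^sup>2 b\<^sub>j\<^sub>k\<close>. This makes the structure coefficients
unique.\<close>
lemma bilinear_form_bigo_cube_zero:
  fixes b :: "'n::finite \<Rightarrow> 'n \<Rightarrow> real"
  assumes "(\<lambda>(x :: real ^ 'n, y :: real ^ 'n). \<Sum>j\<in>UNIV. \<Sum>k\<in>UNIV. b j k * x $ j * y $ k) \<in> O[nhds (0, 0)](\<lambda>p. norm p ^ 3)"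
  shows "b j k = 0"
proof -
  define z where "z t = (t *\<^sub>R axis j 1 :: real ^ 'n, t *\<^sub>R axis k 1 :: real ^ 'n)" for t :: real
  have "filterlim z (nhds (0, 0)) (at 0)"
    unfolding z_def by (intro tendsto_intros tendsto_eq_intros) auto
  from landau_o.big.compose[OF assms this]
  have "(\<lambda>t. case z t of (x, y) \<Rightarrow> \<Sum>j\<in>UNIV. \<Sum>k\<in>UNIV. b j k * x $ j * y $ k) \<in> O[at 0](\<lambda>t. norm (z t) ^ 3)" .
  also have "(\<lambda>t. case z t of (x, y) \<Rightarrow> \<Sum>j\<in>UNIV. \<Sum>k\<in>UNIV. b j k * x $ j * y $ k) = (\<lambda>t. t ^ 2 * b j k)"
  proof -
    have pick: "(\<Sum>l\<in>UNIV. f l * (t *\<^sub>R axis i 1 :: real ^ 'n) $ l) = f i * t" for f i and t :: real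
      by (simp add: axis_def if_distrib[of "\<lambda>r. _ * r"] cong: if_cong)
    have "(\<Sum>j'\<in>UNIV. \<Sum>k'\<in>UNIV. b j' k' * (t *\<^sub>R axis j 1 :: real ^ 'n) $ j' * (t *\<^sub>R axis k 1 :: real ^ 'n) $ k')
        = t ^ 2 * b j k" for t :: real
      unfolding pick using pick[of "\<lambda>j'. b j' k * t" t j] by (simp add: power2_eq_square mult_ac)
    then show ?thesis by (simp add: z_def)
  qed
  also have "(\<lambda>t. norm (z t) ^ 3) = (\<lambda>t. \<bar>t\<bar> ^ 3 * norm (z 1) ^ 3)"
  proof
    fix t
    have "z t = t *\<^sub>R z 1" by (simp add: z_def)
    then show "norm (z t) ^ 3 = \<bar>t\<bar> ^ 3 * norm (z 1) ^ 3" by (simp add: power_mult_distrib)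
  qed
  finally obtain C where C: "\<forall>\<^sub>F t in at 0. norm (t ^ 2 * b j k) \<le> C * norm (\<bar>t\<bar> ^ 3 * norm (z 1) ^ 3)"
    by (elim landau_o.bigE)
  have "\<forall>\<^sub>F t in at 0. norm (b j k) \<le> C * norm (z 1) ^ 3 * \<bar>t\<bar>"
    using C eventually_neq_at_within[of 0 0 UNIV]
  proof eventually_elim
    case (elim t)
    have "\<bar>t\<bar> ^ 2 * \<bar>b j k\<bar> \<le> \<bar>t\<bar> ^ 2 * (C * norm (z 1) ^ 3 * \<bar>t\<bar>)"
      using elim(1) by (simp add: abs_mult power_abs eval_nat_numeral mult_ac)
    then show ?case using elim(2) by (simp add: mult_le_cancel_left_pos)
  qed
  moreover have "((\<lambda>t. C * norm (z 1) ^ 3 * \<bar>t\<bar>) \<longlongrightarrow> 0) (at 0)"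
    by (auto intro!: tendsto_eq_intros)
  ultimately have "((\<lambda>t::real. b j k) \<longlongrightarrow> 0) (at 0)"
    by (rule Lim_null_comparison)
  then show ?thesis by (simp add: tendsto_const_iff)
qed

text \<open>The bilinear part of the expansion of the multiplication satisfies the defining property of the structure coefficients, and
two families with this property differ by a bilinear form of order three, which is zero.\<close>
lemma structure_coeffs_eq:
  assumes "loop_jet B P Q R S T"
    and big: "(\<lambda>z. norm (local_mult c m (fst z) (snd z) - loop_jet.taylor B P Q R S T (fst z) (snd z)))
      \<in> O[nhds (0, 0)](\<lambda>z. norm z ^ 5)"
  shows "structure_coeffs c m i j k = B (axis j 1) (axis k 1) $ i"
proof -
  interpret loop_jet B P Q R S T by fact
  define rem where "rem a i = (\<lambda>(x, y). local_mult c m x y $ i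
        - (x $ i + y $ i + (\<Sum>j\<in>UNIV. \<Sum>k\<in>UNIV. a i j k * x $ j * y $ k)))"
    for i and a :: "'a \<Rightarrow> 'a \<Rightarrow> 'a \<Rightarrow> real"
  define a where "a i j k = B (axis j 1) (axis k 1) $ i" for i j k
  have a: "rem a i \<in> O[nhds (0, 0)](\<lambda>p. norm p ^ 3)" for i
  proof -
    have "rem a i = (\<lambda>z. (local_mult c m (fst z) (snd z) - (fst z + snd z + B (fst z) (snd z))) $ i)"
      by (auto simp: rem_def a_def fun_eq_iff simp flip: B_components)
    also have "\<dots> \<in> O[nhds (0, 0)](\<lambda>z. norm (local_mult c m (fst z) (snd z) - (fst z + snd z + B (fst z) (snd z))))"
      by (intro bigoI[where c = 1] always_eventually) (auto simp del: vector_minus_component simp: component_le_norm_cart)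
    also have "(\<lambda>z. norm (local_mult c m (fst z) (snd z) - (fst z + snd z + B (fst z) (snd z)))) \<in> O[nhds (0, 0)](\<lambda>z. norm z ^ 3)"
      by (rule second_order_remainder[OF big])
    finally show ?thesis .
  qed
  have "structure_coeffs c m = a"
    unfolding structure_coeffs_def
  proof (rule the_equality, fold rem_def)
    show "\<forall>i. rem a i \<in> O[nhds (0, 0)](\<lambda>p. norm p ^ 3)" using a by blast
  next
    fix a' assume a': "\<forall>i. rem a' i \<in> O[nhds (0, 0)](\<lambda>p. norm p ^ 3)"
    show "a' = a"
    proof (intro ext)
      fix i j k
      have "(\<lambda>z. rem a i z - rem a' i z) \<in> O[nhds (0, 0)](\<lambda>p. norm p ^ 3)"
        using a a' by (intro sum_in_bigo(2)) auto
      also have "(\<lambda>z. rem a i z - rem a' i z) = (\<lambda>(x, y). \<Sum>j\<in>UNIV. \<Sum>k\<in>UNIV. (a' i j k - a i j k) * x $ j * y $ k)"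
        by (auto simp: rem_def fun_eq_iff left_diff_distrib sum_subtractf)
      finally show "a' i j k = a i j k"
        using bilinear_form_bigo_cube_zero[of "\<lambda>j k. a' i j k - a i j k" j k] by simp
    qed
  qed
  then show ?thesis by (simp add: a_def)
qed

section \<open>Charts and tangent vectors\<close>

lemma chart_homeomorphism:
  assumes "is_chart c"
  shows "homeomorphism (fst c) (snd c ` fst c) (snd c) (chart_inv c)"
proof -
  obtain \<psi> where \<psi>: "homeomorphism (fst c) (snd c ` fst c) (snd c) \<psi>"
    using assms by (auto simp: is_chart_def)
  have "chart_inv c x = \<psi> x" if x: "x \<in> snd c ` fst c" for x
  proof -
    have "inj_on (snd c) (fst c)"
      using homeomorphism_apply1[OF \<psi>] by (rule inj_on_inverseI)
    moreover obtain g where "x = snd c g" "g \<in> fst c" using x by blast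
    ultimately show ?thesis
      using homeomorphism_apply1[OF \<psi>] by (simp add: chart_inv_def)
  qed
  then show ?thesis by (intro homeomorphism_cong[OF \<psi>]) simp_all
qed

lemma chart_inv_apply:
  assumes "is_chart c" "g \<in> fst c" shows "chart_inv c (snd c g) = g"
  using homeomorphism_apply1[OF chart_homeomorphism[OF assms(1)] assms(2)] .

lemma tendsto_chart_inv:
  assumes "is_chart c" "g \<in> fst c"
  shows "(chart_inv c \<longlongrightarrow> g) (nhds (snd c g))"
proof -
  have "continuous_on (snd c ` fst c) (chart_inv c)" "open (snd c ` fst c)"
    using chart_homeomorphism[OF assms(1)] assms(1) by (auto simp: homeomorphism_def is_chart_def)
  then have "isCont (chart_inv c) (snd c g)"
    using assms(2) by (simp add: continuous_on_eq_continuous_at)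
  then show ?thesis
    using tendsto_at_iff_tendsto_nhds[of "chart_inv c" "snd c g"]
    by (simp add: isCont_def chart_inv_apply[OF assms])
qed

lemma eventually_chart_inv:
  assumes "is_chart c" "g \<in> fst c"
  shows "\<forall>\<^sub>F x in nhds (snd c g). chart_inv c x \<in> fst c \<and> snd c (chart_inv c x) = x"
proof -
  have "\<forall>\<^sub>F x in nhds (snd c g). x \<in> snd c ` fst c"
    using assms by (intro eventually_nhds_in_open) (auto simp: is_chart_def)
  then show ?thesis
    by eventually_elim (auto simp: chart_inv_apply[OF assms(1)])
qed

lemma transition_point:
  assumes "is_chart c" "p \<in> fst c"
  shows "transition c d (snd c p) = snd d p"
  using assms by (simp add: transition_def chart_inv_apply)

lemma charts_at_is_chart: "analytic_manifold A \<Longrightarrow> c \<in> charts_at A p \<Longrightarrow> is_chart c \<and> p \<in> fst c"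
  by (auto simp: analytic_manifold_def charts_at_def)

lemma transition_has_derivative:
  assumes "analytic_manifold A" "c \<in> charts_at A p" "d \<in> charts_at A p"
  shows "(transition c d has_derivative frechet_derivative (transition c d) (at (snd c p))) (at (snd c p))"
proof -
  have "compatible_charts c d" "p \<in> fst c \<inter> fst d"
    using assms by (auto simp: analytic_manifold_def charts_at_def)
  then have "real_analytic_at (transition c d) (snd c p)"
    by (auto simp: compatible_charts_def)
  then show ?thesis
    using real_analytic_imp_differentiable frechet_derivative_works by blast
qed

lemma has_derivative_cong_nhds:
  assumes "(f has_derivative D) (at x)" "\<forall>\<^sub>F y in nhds x. f y = g y"
  shows "(g has_derivative D) (at x)"
proof (rule has_derivative_transform_eventually[OF assms(1)])
  show "\<forall>\<^sub>F y in at x. f y = g y"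
    using assms(2) by (auto simp: eventually_at_filter elim!: eventually_mono)
qed (use eventually_nhds_x_imp_x[OF assms(2)] in simp_all)

text \<open>The chain rule for the composition of coordinate changes.\<close>
lemma transition_cocycle:
  assumes A: "analytic_manifold A" and c: "c \<in> charts_at A p" and d: "d \<in> charts_at A p" and d': "d' \<in> charts_at A p"
  shows "frechet_derivative (transition c d') (at (snd c p)) v =
    frechet_derivative (transition d d') (at (snd d p)) (frechet_derivative (transition c d) (at (snd c p)) v)"
proof -
  note ch = charts_at_is_chart[OF A c] charts_at_is_chart[OF A d]
  have "((\<lambda>x. transition d d' (transition c d x)) has_derivative
      (\<lambda>v. frechet_derivative (transition d d') (at (snd d p)) (frechet_derivative (transition c d) (at (snd c p)) v))) (at (snd c p))"
    using diff_chain_at[OF transition_has_derivative[OF A c d], of "transition d d'"] transition_has_derivative[OF A d d'] ch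
    by (simp add: transition_point o_def)
  moreover have "\<forall>\<^sub>F x in nhds (snd c p). transition d d' (transition c d x) = transition c d' x"
  proof -
    have "\<forall>\<^sub>F x in nhds (snd c p). chart_inv c x \<in> fst d"
      using tendsto_chart_inv[of c p] ch by (intro topological_tendstoD) (auto simp: is_chart_def)
    then show ?thesis
      by eventually_elim (use ch in \<open>auto simp: transition_def chart_inv_apply\<close>)
  qed
  ultimately have "(transition c d' has_derivative
      (\<lambda>v. frechet_derivative (transition d d') (at (snd d p)) (frechet_derivative (transition c d) (at (snd c p)) v))) (at (snd c p))"
    using has_derivative_cong_nhds by blast
  from has_derivative_unique[OF this transition_has_derivative[OF A c d']] show ?thesis
    by (simp add: fun_eq_iff)
qed

lemma transition_self:
  assumes "analytic_manifold A" "c \<in> charts_at A p"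
  shows "frechet_derivative (transition c c) (at (snd c p)) = id"
proof -
  note ch = charts_at_is_chart[OF assms]
  have "\<forall>\<^sub>F x in nhds (snd c p). x = transition c c x"
    using eventually_chart_inv[of c p] ch by (auto simp: transition_def elim!: eventually_mono)
  moreover have "((\<lambda>x. x) has_derivative id) (at (snd c p))"
    using has_derivative_id by (simp add: id_def)
  ultimately have "(transition c c has_derivative id) (at (snd c p))"
    using has_derivative_cong_nhds by blast
  then show ?thesis by (rule frechet_derivative_at[symmetric])
qed

lemma tangent_vector_outside: "v \<in> tangent_space A p \<Longrightarrow> c \<notin> charts_at A p \<Longrightarrow> v c = 0"
  unfolding tangent_space_def by blast

lemma subspace_tangent_space:
  assumes A: "analytic_manifold A"
  shows "subspace (tangent_space A p)"
proof -
  have lin: "linear (frechet_derivative (transition c d) (at (snd c p)))"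
    if "c \<in> charts_at A p" "d \<in> charts_at A p" for c d
    using transition_has_derivative[OF A that] has_derivative_linear by blast
  show ?thesis
  proof (rule subspaceI)
    show "0 \<in> tangent_space A p"
      using linear_map_simps(5)[OF lin] by (simp add: tangent_space_def)
  next
    fix v w assume vw: "v \<in> tangent_space A p" "w \<in> tangent_space A p"
    have "(v + w) d = frechet_derivative (transition c d) (at (snd c p)) ((v + w) c)"
      if "c \<in> charts_at A p" "d \<in> charts_at A p" for c d
    proof -
      have "v d = frechet_derivative (transition c d) (at (snd c p)) (v c)"
        "w d = frechet_derivative (transition c d) (at (snd c p)) (w c)"
        using vw that unfolding tangent_space_def by blast+
      then show ?thesis by (simp only: plus_fun_apply linear_map_simps(1)[OF lin[OF that]])
    qed
    moreover have "(v + w) c = 0" if "c \<notin> charts_at A p" for c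
      using vw[THEN tangent_vector_outside] that by simp
    ultimately show "v + w \<in> tangent_space A p" unfolding tangent_space_def by blast
  next
    fix r v assume v: "v \<in> tangent_space A p"
    have "(r *\<^sub>R v) d = frechet_derivative (transition c d) (at (snd c p)) ((r *\<^sub>R v) c)"
      if "c \<in> charts_at A p" "d \<in> charts_at A p" for c d
    proof -
      have "v d = frechet_derivative (transition c d) (at (snd c p)) (v c)"
        using v that unfolding tangent_space_def by blast
      then show ?thesis by (simp only: scaleR_fun_def linear_map_simps(3)[OF lin[OF that]])
    qed
    moreover have "(r *\<^sub>R v) c = 0" if "c \<notin> charts_at A p" for c
      using tangent_vector_outside[OF v that] by (simp add: scaleR_fun_def)
    ultimately show "r *\<^sub>R v \<in> tangent_space A p" unfolding tangent_space_def by blast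
  qed
qed

lemma tangent_vector_eqI:
  assumes "v \<in> tangent_space A p" "w \<in> tangent_space A p" "c \<in> charts_at A p" "v c = w c"
  shows "v = w"
proof
  fix d show "v d = w d"
  proof (cases "d \<in> charts_at A p")
    case True
    then have "v d = frechet_derivative (transition c d) (at (snd c p)) (v c)"
      "w d = frechet_derivative (transition c d) (at (snd c p)) (w c)"
      using assms(1-3) unfolding tangent_space_def by blast+
    then show ?thesis using assms(4) by simp
  next
    case False
    then show ?thesis using assms(1,2)[THEN tangent_vector_outside] by simp
  qed
qed

text \<open>Together with \<open>tangent_vector_eqI\<close>: a tangent vector is the same as its components in one chart. The
transformation rule for the vector constructed here is the chain rule for coordinate changes.\<close>
lemma ex_tangent_vector:
  assumes A: "analytic_manifold A" and c: "c \<in> charts_at A p"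
  shows "\<exists>v\<in>tangent_space A p. v c = \<xi>"
proof -
  define v where "v d = (if d \<in> charts_at A p then frechet_derivative (transition c d) (at (snd c p)) \<xi> else 0)" for d
  have "v \<in> tangent_space A p"
    unfolding tangent_space_def
  proof (intro CollectI conjI ballI allI impI)
    fix d d' assume d: "d \<in> charts_at A p" "d' \<in> charts_at A p"
    show "v d' = frechet_derivative (transition d d') (at (snd d p)) (v d)"
      using transition_cocycle[OF A c d, of \<xi>] d by (simp only: v_def if_True)
  qed (simp add: v_def)
  moreover have "v c = \<xi>" using c transition_self[OF A c] by (simp add: v_def)
  ultimately show ?thesis by blast
qed

section \<open>The tangent algebra of a local analytic Moufang loop\<close>

text \<open>The ternary bracket is built from the binary one, so an injective linear map that preserves the
binary bracket preserves both, and each identity can be checked on the image.\<close>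
lemma general_Lie_triple_system_transfer:
  assumes GL: "general_Lie_triple_system UNIV br (yamaguti_bracket br)"
    and M: "subspace M" and \<phi>: "linear \<phi>" "inj_on \<phi> M"
    and B: "\<And>x y. x \<in> M \<Longrightarrow> y \<in> M \<Longrightarrow> B x y \<in> M \<and> \<phi> (B x y) = br (\<phi> x) (\<phi> y)"
  shows "general_Lie_triple_system M B (yamaguti_bracket B)"
proof -
  interpret br: general_Lie_triple_system UNIV br "yamaguti_bracket br" by (rule GL)
  have closed: "B x y \<in> M" "x + y \<in> M" "x - y \<in> M" "r *\<^sub>R x \<in> M" "- x \<in> M" if "x \<in> M" "y \<in> M" for x y r
    using B M that by (auto simp: subspace_add subspace_diff subspace_scale subspace_neg)
  have zero: "0 \<in> M" using M by (rule subspace_0)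
  have T: "yamaguti_bracket B x y z \<in> M" "\<phi> (yamaguti_bracket B x y z) = yamaguti_bracket br (\<phi> x) (\<phi> y) (\<phi> z)"
    if "x \<in> M" "y \<in> M" "z \<in> M" for x y z
    using that by (simp_all add: yamaguti_bracket_def closed B linear_map_simps[OF \<phi>(1)])
  have eqI: "x = y" if "\<phi> x = \<phi> y" "x \<in> M" "y \<in> M" for x y
    using \<phi>(2) that by (rule inj_onD)
  note \<phi>_simps = linear_map_simps[OF \<phi>(1)] B T closed zero
  have br_lin: "br (x + y) z = br x z + br y z" "br z (x + y) = br z x + br z y"
      "br (r *\<^sub>R x) y = r *\<^sub>R br x y" "br x (r *\<^sub>R y) = r *\<^sub>R br x y" for x y z r
    using br.bilinear by (auto simp: linear_map_on_def)
  have T_lin: "yamaguti_bracket br (x + y) z w = yamaguti_bracket br x z w + yamaguti_bracket br y z w"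
      "yamaguti_bracket br z (x + y) w = yamaguti_bracket br z x w + yamaguti_bracket br z y w"
      "yamaguti_bracket br z w (x + y) = yamaguti_bracket br z w x + yamaguti_bracket br z w y"
      "yamaguti_bracket br (r *\<^sub>R x) z w = r *\<^sub>R yamaguti_bracket br x z w"
      "yamaguti_bracket br z (r *\<^sub>R x) w = r *\<^sub>R yamaguti_bracket br z x w"
      "yamaguti_bracket br z w (r *\<^sub>R x) = r *\<^sub>R yamaguti_bracket br z w x" for x y z w r
    using br.trilinear by (auto simp: linear_map_on_def)
  show ?thesis
  proof
    show "subspace M" by fact
    show "linear_map_on M (\<lambda>z. B z y) \<and> linear_map_on M (B x)" if "x \<in> M" "y \<in> M" for x y
      using that by (auto intro!: eqI simp: linear_map_on_def \<phi>_simps br_lin)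
    show "linear_map_on M (\<lambda>w. yamaguti_bracket B w y z) \<and> linear_map_on M (\<lambda>w. yamaguti_bracket B x w z) \<and>
        linear_map_on M (yamaguti_bracket B x y)" if "x \<in> M" "y \<in> M" "z \<in> M" for x y z
      using that by (auto intro!: eqI simp: linear_map_on_def \<phi>_simps T_lin)
  qed (rule eqI; simp add: \<phi>_simps; (rule br.B_skew br.T_skew br.T_cyclic br.T_B_cyclic br.T_deriv_B br.T_deriv_T; simp))+
qed

lemma tendsto_loop_mult:
  assumes "analytic_mult A D m" "open D" "(e, e) \<in> D" "m e e = e"
    and "(f \<longlongrightarrow> e) F" "(g \<longlongrightarrow> e) F"
  shows "((\<lambda>t. m (f t) (g t)) \<longlongrightarrow> e) F"
proof -
  have "isCont (\<lambda>(g, h). m g h) (e, e)"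
    using assms by (simp add: analytic_mult_def continuous_on_eq_continuous_at)
  then have "((\<lambda>t. (\<lambda>(g, h). m g h) (f t, g t)) \<longlongrightarrow> (\<lambda>(g, h). m g h) (e, e)) F"
    by (rule isCont_tendsto_compose) (intro tendsto_Pair assms)
  then show ?thesis using assms(4) by simp
qed

theorem theorem6p2:
  fixes A :: "('g::t2_space, 'n::finite) chart set"
    and e :: 'g
    and D :: "('g \<times> 'g) set"
    and m :: "'g \<Rightarrow> 'g \<Rightarrow> 'g"
    and c :: "('g, 'n) chart"
  assumes "local_analytic_Moufang_loop A e D m"
    and "c \<in> centred_charts A e"
  shows "general_Lie_triple_system (tangent_space A e) (tangent_bracket A e m c)
           (yamaguti_bracket (tangent_bracket A e m c))"
proof -
  have A: "analytic_manifold A" and D: "open D" "(e, e) \<in> D" and mult: "analytic_mult A D m"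
    and unit: "\<forall>\<^sub>F g in nhds e. m e g = g \<and> m g e = g"
    using assms(1) by (auto simp: local_analytic_Moufang_loop_def)
  have "\<exists>V. open V \<and> e \<in> V \<and> (\<forall>a\<in>V. \<forall>g\<in>V. \<forall>h\<in>V.
      {(a, g), (h, a), (g, h), (m a g, m h a), (a, m g h), (m a (m g h), a)} \<subseteq> D \<and>
      m (m a g) (m h a) = m (m a (m g h)) a)"
    using assms(1) unfolding local_analytic_Moufang_loop_def by (elim conjE)
  then obtain V where V: "open V" "e \<in> V" and V': "\<forall>a\<in>V. \<forall>g\<in>V. \<forall>h\<in>V.
      {(a, g), (h, a), (g, h), (m a g, m h a), (a, m g h), (m a (m g h), a)} \<subseteq> D \<and>
      m (m a g) (m h a) = m (m a (m g h)) a"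
    by (elim exE conjE)
  have Moufang: "m (m a g) (m h a) = m (m a (m g h)) a" if "a \<in> V" "g \<in> V" "h \<in> V" for a g h
    using V'[THEN bspec, OF that(1), THEN bspec, OF that(2), THEN bspec, OF that(3)] by (rule conjunct2)
  have c: "c \<in> charts_at A e" and c0: "snd c e = 0"
    using assms(2) by (auto simp: centred_charts_def)
  note chart = charts_at_is_chart[OF A c]
  have ee: "m e e = e" using eventually_nhds_x_imp_x[OF unit] by simp
  have inv: "(chart_inv c \<longlongrightarrow> e) (nhds 0)"
    using tendsto_chart_inv[of c e] chart by (simp add: c0)
  have dom: "\<forall>\<^sub>F t in F. f t \<in> fst c" if "(f \<longlongrightarrow> e) F" for f and F :: "real filter"
    using that chart by (intro topological_tendstoD) (auto simp: is_chart_def)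
  define F where "F = local_mult c m"
  \<comment> \<open>Products of points close to \<open>e\<close> stay in the chart, so near the origin \<open>F\<close> satisfies the laws
    of the loop.\<close>

  have "\<forall>b\<in>charts_at A e. \<forall>c\<in>charts_at A e. \<forall>d\<in>charts_at A e.
      real_analytic_at (\<lambda>(x, y). snd d (m (chart_inv b x) (chart_inv c y))) (snd b e, snd c e)"
    using mult[unfolded analytic_mult_def, THEN conjunct2, THEN bspec, OF D(2)] by (simp only: prod.case ee)
  from this[THEN bspec, OF c, THEN bspec, OF c, THEN bspec, OF c]
  have "real_analytic_at (\<lambda>(x, y). F x y) (0, 0)"
    by (simp add: F_def local_mult_def c0)
  moreover have "\<forall>\<^sub>F x in nhds 0. F x 0 = x \<and> F 0 x = x"
  proof -
    have "\<forall>\<^sub>F x in nhds 0. m e (chart_inv c x) = chart_inv c x \<and> m (chart_inv c x) e = chart_inv c x"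
      using inv unit by (auto simp: filterlim_iff)
    moreover have "\<forall>\<^sub>F x in nhds 0. chart_inv c x \<in> fst c \<and> snd c (chart_inv c x) = x"
      using eventually_chart_inv[of c e] chart by (simp add: c0)
    ultimately show ?thesis
      by eventually_elim (use chart_inv_apply[of c e] chart in \<open>simp add: F_def local_mult_def c0\<close>)
  qed
  ultimately obtain B P Q R S T where jet: "loop_jet B P Q R S T"
    and big: "(\<lambda>z. norm (F (fst z) (snd z) - loop_jet.taylor B P Q R S T (fst z) (snd z))) \<in> O[nhds (0, 0)](\<lambda>z. norm z ^ 5)"
    by (rule loop_expansion)
  have "Moufang_jet B P Q R S T"
  proof (rule Moufang_expansion[OF jet big])
    fix a g h :: "real ^ 'n"
    define p where "p x t = chart_inv c (t *\<^sub>R x)" for x and t :: real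
    have p: "(p x \<longlongrightarrow> e) (at 0)" for x
    proof -
      have "((\<lambda>t. t *\<^sub>R x) \<longlongrightarrow> 0) (at 0)" by (auto intro!: tendsto_eq_intros)
      then show ?thesis unfolding p_def by (rule filterlim_compose[OF inv])
    qed
    note mult_lim = tendsto_loop_mult[OF mult D ee]
    have pV: "\<forall>\<^sub>F t in at 0. p x t \<in> V" for x
      using p V by (rule topological_tendstoD)
    show "\<forall>\<^sub>F t in at 0. F (F (t *\<^sub>R a) (t *\<^sub>R g)) (F (t *\<^sub>R h) (t *\<^sub>R a)) =
        F (F (t *\<^sub>R a) (F (t *\<^sub>R g) (t *\<^sub>R h))) (t *\<^sub>R a)"
      using pV[of a] pV[of g] pV[of h] dom[OF mult_lim[OF p[of a] p[of g]]] dom[OF mult_lim[OF p[of h] p[of a]]]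
        dom[OF mult_lim[OF p[of g] p[of h]]] dom[OF mult_lim[OF p[of a] mult_lim[OF p[of g] p[of h]]]]
      by eventually_elim
        (use chart Moufang in \<open>simp add: F_def local_mult_def chart_inv_apply p_def\<close>)
  qed
  then interpret Moufang_jet B P Q R S T .
  interpret br: Malcev_bracket bracket
  proof
    show "bilinear bracket"
      by (auto simp: bilinear_def bracket_def multilinear_simps algebra_simps intro!: linearI)
    show "bracket y x = - bracket x y" for x y by (simp add: bracket_def)
  qed (rule bracket_Malcev_identity)
  show ?thesis
  proof (rule general_Lie_triple_system_transfer[OF br.is_general_Lie_triple_system subspace_tangent_space[OF A]])
    show "linear (\<lambda>v. v c)" by (rule linearI) (simp_all add: scaleR_fun_def)
    show "inj_on (\<lambda>v. v c) (tangent_space A e)"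
      using tangent_vector_eqI[OF _ _ c] by (intro inj_onI)
    fix v w assume "v \<in> tangent_space A e" "w \<in> tangent_space A e"
    have br: "(\<Sum>j\<in>UNIV. \<Sum>k\<in>UNIV. (structure_coeffs c m i j k - structure_coeffs c m i k j) * v c $ j * w c $ k)
        = bracket (v c) (w c) $ i" for i
    proof -
      have "B (w c) (v c) $ i = (\<Sum>j\<in>UNIV. \<Sum>k\<in>UNIV. B (axis k 1) (axis j 1) $ i * v c $ j * w c $ k)"
        unfolding B_components[of "w c"] by (subst sum.swap) (simp add: mult_ac)
      then show ?thesis
        using B_components[of "v c" "w c" i]
        by (simp add: structure_coeffs_eq[OF jet big[unfolded F_def]] bracket_def left_diff_distrib sum_subtractf)
    qed
    obtain u where u: "u \<in> tangent_space A e" "u c = bracket (v c) (w c)"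
      using ex_tangent_vector[OF A c] by blast
    have "tangent_bracket A e m c v w = u"
      unfolding tangent_bracket_def br
    proof (rule the_equality)
      show "u \<in> tangent_space A e \<and> (\<forall>i. u c $ i = bracket (v c) (w c) $ i)"
        using u by simp
    next
      fix u' assume u': "u' \<in> tangent_space A e \<and> (\<forall>i. u' c $ i = bracket (v c) (w c) $ i)"
      then have "u' c = u c" using u(2) by (simp add: vec_eq_iff)
      with u' u(1) c show "u' = u" by (blast intro: tangent_vector_eqI)
    qed
    then show "tangent_bracket A e m c v w \<in> tangent_space A e \<and>
        tangent_bracket A e m c v w c = bracket (v c) (w c)"
      using u by simp
  qed
qed

end
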